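(* Let $\Phi:[0,1]\to\mathbb R$ be a continuous convex function and let $\rho\in[0,1]$. For every $n\ge 1$ and every balanced Boolean function $f:\{\pm1\}^n\to\{0,1\}$, $$\mathbb E_\mu[\Phi(T_\rho f)]\le\min_{i\in[n]}\Gamma(\tilde d_i(f))\le\Gamma(\tilde d(f)),$$ where for $\epsilon\in[0,1]$, $$\Gamma(\epsilon):=\frac12\int_0^1\Big(\Phi\big(\tfrac{1+\rho}2\theta_{1-\epsilon}(\beta)+\tfrac{1-\rho}2\theta_\epsilon(\beta)\big)+\Phi\big(\tfrac{1-\rho}2\theta_{1-\epsilon}(\beta)+\tfrac{1+\rho}2\theta_\epsilon(\beta)\big)\Big)\,\mathrm d\beta .$$
   Context: $\mu$ is the uniform measure on $\{\pm1\}^n$, $\mathbf X\sim\mu$; $\mathbf Y$ is obtained from $\mathbf X$ by flipping each coordinate's sign independently with probability $\frac{1-\rho}2$; $T_\rho f(\mathbf x)=\mathbb E[f(\mathbf Y)\mid\mathbf X=\mathbf x]$. $f$ is balanced if $\mathbb E_\mu f=1/2$. With $A=f^{-1}(1)$, $C_i=\{\mathbf x:x_i=1\}$: $d_i(f)=\mu(A\Delta C_i)$, $\tilde d_i(f)=\min\{d_i(f),1-d_i(f)\}$, $\tilde d(f)=\min_{i\in[n]}\tilde d_i(f)$. Definition of $\theta_\alpha$. For $\alpha,\beta\in[0,1]$ write $s=\sqrt{-2\ln\alpha}$, $t=\sqrt{-2\ln\beta}$ (so $\alpha=e^{-s^2/2}$, $\beta=e^{-t^2/2}$) and $$\Theta_0(\alpha,\beta)=\begin{cases}\exp\!\big(-\frac{s^2+t^2-2\rho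 st}{2(1-\rho^2)}\big),&\rho s\le t\le s/\rho,\\ \exp(-s^2/2)=\alpha,&0\le t\le\rho s,\\ \exp(-t^2/2)=\beta,&t\ge s/\rho,\end{cases}$$ where degenerate cases are read by continuity: $\Theta_0=0$ if $\alpha\beta=0$, $\Theta_0=\alpha\beta$ if $\rho=0$, $\Theta_0=\min\{\alpha,\beta\}$ if $\rho=1$. Put $\Theta(\alpha,\beta)=\min\{\Theta_0(\alpha,\beta),\ \alpha+\beta-1+\Theta_0(1-\alpha,1-\beta)\}$ and $\theta_\alpha(\beta)=\frac{\partial\Theta(\alpha,\beta)}{\partial\beta}$, which is defined for almost every $\beta\in[0,1]$. *)

theory Defs
  imports "HOL-Probability.Probability"
begin

text \<open>
  Points of the cube are functions on the index set \<open>{1..n}\<close>, extended by \<open>undefined\<close>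
  elsewhere, so that extensional equality is equality of the \<open>n\<close> coordinates.
\<close>

definition cube :: "nat \<Rightarrow> (nat \<Rightarrow> int) set" where
  "cube n = PiE {1..n} (\<lambda>_. {-1, 1})"

definition cube_pmf :: "nat \<Rightarrow> (nat \<Rightarrow> int) pmf" where
  "cube_pmf n = pmf_of_set (cube n)"

definition flip_pmf :: "nat \<Rightarrow> real \<Rightarrow> (nat \<Rightarrow> int) \<Rightarrow> (nat \<Rightarrow> int) pmf" where
  "flip_pmf n \<rho> x =
     Pi_pmf {1..n} undefined
       (\<lambda>i. map_pmf (\<lambda>b. if b then - x i else x i) (bernoulli_pmf ((1 - \<rho>) / 2)))"

text \<open>The joint law of \<open>(X, Y)\<close>.\<close>

definition XY_pmf :: "nat \<Rightarrow> real \<Rightarrow> ((nat \<Rightarrow> int) \<times> (nat \<Rightarrow> int)) pmf" where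
  "XY_pmf n \<rho> = bind_pmf (cube_pmf n) (\<lambda>x. map_pmf (Pair x) (flip_pmf n \<rho> x))"

definition noise_op :: "nat \<Rightarrow> real \<Rightarrow> ((nat \<Rightarrow> int) \<Rightarrow> real) \<Rightarrow> (nat \<Rightarrow> int) \<Rightarrow> real" where
  "noise_op n \<rho> f x =
     measure_pmf.expectation (cond_pmf (XY_pmf n \<rho>) {p. fst p = x}) (\<lambda>p. f (snd p))"

definition boolean_fun :: "nat \<Rightarrow> ((nat \<Rightarrow> int) \<Rightarrow> real) \<Rightarrow> bool" where
  "boolean_fun n f \<longleftrightarrow> f \<in> cube n \<rightarrow> {0, 1}"

definition balanced :: "nat \<Rightarrow> ((nat \<Rightarrow> int) \<Rightarrow> real) \<Rightarrow> bool" where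
  "balanced n f \<longleftrightarrow> measure_pmf.expectation (cube_pmf n) f = 1 / 2"

definition dict_dist :: "nat \<Rightarrow> ((nat \<Rightarrow> int) \<Rightarrow> real) \<Rightarrow> nat \<Rightarrow> real" where
  "dict_dist n f i =
     measure_pmf.prob (cube_pmf n) (sym_diff {x \<in> cube n. f x = 1} {x \<in> cube n. x i = 1})"

definition sym_dict_dist :: "nat \<Rightarrow> ((nat \<Rightarrow> int) \<Rightarrow> real) \<Rightarrow> nat \<Rightarrow> real" where
  "sym_dict_dist n f i = min (dict_dist n f i) (1 - dict_dist n f i)"

definition min_dict_dist :: "nat \<Rightarrow> ((nat \<Rightarrow> int) \<Rightarrow> real) \<Rightarrow> real" where
  "min_dict_dist n f = Min (sym_dict_dist n f ` {1..n})"

text \<open>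
  The degenerate values \<open>\<alpha>\<beta> = 0\<close>, \<open>\<rho> = 0\<close>, \<open>\<rho> = 1\<close> are split off first, since \<open>ln 0\<close> and
  division by \<open>0\<close> do not have their limiting values here. The three main cases agree where they
  overlap, so their order is immaterial; after the first two tests the last one is \<open>t \<ge> s / \<rho>\<close>.
\<close>

definition Theta0 :: "real \<Rightarrow> real \<Rightarrow> real \<Rightarrow> real" where
  "Theta0 \<rho> \<alpha> \<beta> =
     (if \<alpha> * \<beta> = 0 then 0
      else if \<rho> = 0 then \<alpha> * \<beta>
      else if \<rho> = 1 then min \<alpha> \<beta>
      else
        let s = sqrt (- 2 * ln \<alpha>); t = sqrt (- 2 * ln \<beta>) in
          if \<rho> * s \<le> t \<and> t \<le> s / \<rho>
            then exp (- (s\<^sup>2 + t\<^sup>2 - 2 * \<rho> * s * t) / (2 * (1 - \<rho>\<^sup>2)))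
          else if t \<le> \<rho> * s then \<alpha>
          else \<beta>)"

definition Theta :: "real \<Rightarrow> real \<Rightarrow> real \<Rightarrow> real" where
  "Theta \<rho> \<alpha> \<beta> = min (Theta0 \<rho> \<alpha> \<beta>) (\<alpha> + \<beta> - 1 + Theta0 \<rho> (1 - \<alpha>) (1 - \<beta>))"

text \<open>
  The partial derivative in \<open>\<beta>\<close>. Only values at \<open>\<beta> \<in> (0, 1)\<close> where the derivative exists
  matter, as this function is only used under an integral over \<open>[0, 1]\<close>; at the remaining null
  set of points its value is unspecified.
\<close>

definition theta :: "real \<Rightarrow> real \<Rightarrow> real \<Rightarrow> real" where
  "theta \<rho> \<alpha> \<beta> = deriv (\<lambda>b. Theta \<rho> \<alpha> b) \<beta>"

definition Gam :: "(real \<Rightarrow> real) \<Rightarrow> real \<Rightarrow> real \<Rightarrow> real" where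
  "Gam \<Phi> \<rho> \<epsilon> =
     1 / 2 * integral {0..1} (\<lambda>\<beta>.
       \<Phi> ((1 + \<rho>) / 2 * theta \<rho> (1 - \<epsilon>) \<beta> + (1 - \<rho>) / 2 * theta \<rho> \<epsilon> \<beta>) +
       \<Phi> ((1 - \<rho>) / 2 * theta \<rho> (1 - \<epsilon>) \<beta> + (1 + \<rho>) / 2 * theta \<rho> \<epsilon> \<beta>))"

lemma finite_cube [simp]: "finite (cube n)"
  by (auto simp: cube_def intro: finite_PiE)

lemma cube_nonempty [simp]: "cube n \<noteq> {}"
  by (simp add: cube_def PiE_eq_empty_iff)

lemma set_cube_pmf [simp]: "set_pmf (cube_pmf n) = cube n"
  by (simp add: cube_pmf_def)

lemma map_fst_XY_pmf: "map_pmf fst (XY_pmf n \<rho>) = cube_pmf n"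
  by (simp add: XY_pmf_def map_bind_pmf map_pmf_comp map_pmf_const bind_return_pmf')

lemma pmf_map_Pair: "pmf (map_pmf (Pair x) q) (a, b) = (if a = x then pmf q b else 0)"
proof (cases "a = x")
  case True
  then show ?thesis by (simp add: pmf_map_inj' inj_on_def)
next
  case False
  then have "(a, b) \<notin> set_pmf (map_pmf (Pair x) q)" by auto
  with False show ?thesis by (metis set_pmf_iff)
qed

lemma pmf_XY_pmf:
  "pmf (XY_pmf n \<rho>) (a, b) = pmf (cube_pmf n) a * pmf (flip_pmf n \<rho> a) b"
proof -
  have "pmf (XY_pmf n \<rho>) (a, b) =
      measure_pmf.expectation (cube_pmf n) (\<lambda>x. if a = x then pmf (flip_pmf n \<rho> x) b else 0)"
    by (simp add: XY_pmf_def pmf_bind pmf_map_Pair)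
  also have "\<dots> = measure_pmf.expectation (cube_pmf n)
      (\<lambda>x. pmf (flip_pmf n \<rho> a) b * indicator {a} x)"
    by (intro arg_cong2[where f = "integral\<^sup>L"] refl ext) auto
  also have "\<dots> = pmf (flip_pmf n \<rho> a) b * measure_pmf.prob (cube_pmf n) {a}"
    by simp
  finally show ?thesis by (simp add: measure_pmf_single)
qed

lemma noise_op_eq:
  assumes x: "x \<in> cube n"
  shows "noise_op n \<rho> f x = measure_pmf.expectation (flip_pmf n \<rho> x) f"
proof -
  have px: "pmf (cube_pmf n) x \<noteq> 0"
    using x by (simp flip: set_pmf_iff)
  have m: "measure_pmf.prob (XY_pmf n \<rho>) {p. fst p = x} = pmf (cube_pmf n) x"
    by (simp add: map_fst_XY_pmf[of n \<rho>, symmetric] pmf_map vimage_def)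
  have ne: "set_pmf (XY_pmf n \<rho>) \<inter> {p. fst p = x} \<noteq> {}"
  proof
    assume "set_pmf (XY_pmf n \<rho>) \<inter> {p. fst p = x} = {}"
    then have "measure_pmf.prob (XY_pmf n \<rho>) {p. fst p = x} = 0"
      by (simp add: measure_pmf_zero_iff)
    with m px show False by simp
  qed
  have "cond_pmf (XY_pmf n \<rho>) {p. fst p = x} = map_pmf (Pair x) (flip_pmf n \<rho> x)"
  proof (rule pmf_eqI)
    fix p :: "(nat \<Rightarrow> int) \<times> (nat \<Rightarrow> int)"
    obtain a b where p: "p = (a, b)" by (cases p)
    show "pmf (cond_pmf (XY_pmf n \<rho>) {p. fst p = x}) p =
        pmf (map_pmf (Pair x) (flip_pmf n \<rho> x)) p"
      using px by (auto simp: p pmf_cond[OF ne] m pmf_XY_pmf pmf_map_Pair)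
  qed
  then show ?thesis by (simp add: noise_op_def)
qed

end

theory Submission
  imports Defs
begin

text \<open>
  Fix a coordinate \<open>i\<close>. On the facets \<open>x\<^sub>i = 1\<close> and \<open>x\<^sub>i = -1\<close> the noisy function is a mixture,
  with weights \<open>(1 + \<rho>) / 2\<close> and \<open>(1 - \<rho>) / 2\<close> in one or the other order, of the noisy versions
  of the restrictions \<open>f\<^sub>1\<close> and \<open>f\<^sub>2\<close> of \<open>f\<close>. Since \<open>f\<close> is balanced, these have means
  \<open>1 - d\<close> and \<open>d\<close>, where \<open>d\<close> is the distance of \<open>f\<close> from the dictator \<open>i\<close>. The theorem thus
  reduces to the statement that a noisy indicator function of mean \<open>\<alpha>\<close> is majorized by \<open>theta \<rho> \<alpha>\<close>:
  its normalized sum over a set of density \<open>\<beta>\<close> is bounded by the integral of \<open>theta \<rho> \<alpha>\<close> over \<open>[0, \<beta>]\<close>, that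
  is, by \<open>Theta \<rho> \<alpha> \<beta>\<close>. Because this holds for all sets, it is inherited by mixtures
  (\<open>noise_convex_combination_le_integral\<close>), and a Hardy-Littlewood-Polya argument
  (\<open>majorization_integral\<close>) turns it into the inequality for the convex function \<open>\<Phi>\<close>.

  The bound by \<open>Theta\<close> is a small-set expansion estimate: a pair of sets of densities \<open>\<alpha>\<close> and \<open>\<beta>\<close>
  has noise stability at most \<open>\<alpha>\<^bsup>1/p\<^esup> \<beta>\<^bsup>1/q\<^esup>\<close> whenever \<open>(p - 1) (q - 1) = \<rho>\<^sup>2\<close>, by
  two-function hypercontractivity (\<open>two_function_hypercontractive\<close>), and \<open>Theta0\<close> is the minimum of
  these bounds and their limiting cases. The second half of \<open>Theta\<close> is the same estimate for the complements. As a minimum of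
  concave functions, \<open>Theta\<close> is concave in \<open>\<beta>\<close>; therefore its derivative exists off a countable
  set and integrates back to \<open>Theta\<close> (\<open>theta_representative\<close>).

  Hypercontractivity itself is proved on a single bit by Gross's method, from a logarithmic Sobolev
  inequality on two points, and extended to the cube by induction on the coordinates.
\<close>


section \<open>Hypercontractivity on two points\<close>

lemma sinh_mult_le:
  fixes k x :: real
  assumes "0 \<le> k" "k \<le> 1" "0 \<le> x"
  shows "sinh (k * x) \<le> k * sinh x"
proof -
  have "k * sinh 0 - sinh (k * 0) \<le> k * sinh x - sinh (k * x)"
  proof (rule DERIV_nonneg_imp_nondecreasing[OF assms(3)])
    fix y :: real assume y: "0 \<le> y" "y \<le> x"
    have "((\<lambda>y. k * sinh y - sinh (k * y)) has_real_derivative k * (cosh y - cosh (k * y))) (at y)"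
      by (auto intro!: derivative_eq_intros simp: algebra_simps)
    moreover have "cosh (k * y) \<le> cosh y"
      using assms y by (simp add: cosh_real_nonneg_le_iff mult_left_le_one_le)
    ultimately show "\<exists>d. ((\<lambda>y. k * sinh y - sinh (k * y)) has_real_derivative d) (at y) \<and> 0 \<le> d"
      using assms(1) by fastforce
  qed
  then show ?thesis by simp
qed

text \<open>
  Since \<open>cosh t - 1 = 2 sinh\<^sup>2 (t / 2)\<close> and \<open>\<bar>p - 2\<bar> \<le> p\<close>, this is the convexity of \<open>sinh\<close> on
  the half line, squared. It is the analytic content of the Stroock-Varopoulos inequality below.
\<close>

lemma cosh_minus_1_le:
  fixes p z :: real
  assumes "1 < p"
  shows "p\<^sup>2 * (cosh ((p - 2) * z) - 1) \<le> (p - 2)\<^sup>2 * (cosh (p * z) - 1)"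
proof -
  have half: "cosh t - 1 = 2 * (sinh (\<bar>t\<bar> / 2))\<^sup>2" for t :: real
    using cosh_double[of "\<bar>t\<bar> / 2"] by (simp add: cosh_square_eq)
  have "sinh (\<bar>p - 2\<bar> / p * (p * \<bar>z\<bar> / 2)) \<le> \<bar>p - 2\<bar> / p * sinh (p * \<bar>z\<bar> / 2)"
    using assms by (intro sinh_mult_le) auto
  then have "p * sinh (\<bar>(p - 2) * z\<bar> / 2) \<le> \<bar>p - 2\<bar> * sinh (\<bar>p * z\<bar> / 2)"
    using assms unfolding abs_mult by (simp add: field_simps)
  then have "(p * sinh (\<bar>(p - 2) * z\<bar> / 2))\<^sup>2 \<le> (\<bar>p - 2\<bar> * sinh (\<bar>p * z\<bar> / 2))\<^sup>2"
    using assms by (intro power_mono) auto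
  then show ?thesis
    by (simp add: half power_mult_distrib)
qed

text \<open>
  The Stroock-Varopoulos inequality on two points compares the Dirichlet form of \<open>u\<close> against
  \<open>u\<^bsup>p-1\<^esup>\<close> with that of \<open>u\<^bsup>p/2\<^esup>\<close>, and so reduces the logarithmic Sobolev inequality for an
  exponent \<open>p\<close> to the exponent 2. In the variable \<open>z = ln (u / v) / 2\<close> both sides are
  multiples of values of \<open>cosh\<close>; the constant fits because \<open>p\<^sup>2 - 4 (p - 1) = (p - 2)\<^sup>2\<close>.
\<close>

lemma stroock_varopoulos:
  fixes u v p :: real
  assumes "0 < u" "0 < v" "1 < p"
  shows "4 * (p - 1) * (u powr (p / 2) - v powr (p / 2))\<^sup>2
       \<le> p\<^sup>2 * ((u - v) * (u powr (p - 1) - v powr (p - 1)))"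
proof -
  obtain a b where u: "u = exp a" and v: "v = exp b"
    using assms by (metis exp_ln)
  define z G where "z = (a - b) / 2" and "G = exp (p * (a + b) / 2)"
  have eqs: "exp (p * a) = G * exp (p * z)" "exp (p * b) = G * exp (- (p * z))"
    "exp (a + (p - 1) * b) = G * exp (- ((p - 2) * z))" "exp (b + (p - 1) * a) = G * exp ((p - 2) * z)"
    unfolding G_def z_def mult_exp_exp exp_inj_iff by (simp_all add: field_simps)
  have G: "exp (p * (a + b) / 2) = G" by (simp add: G_def)
  have "(u powr (p / 2) - v powr (p / 2))\<^sup>2
      = exp (p * a) + exp (p * b) - 2 * exp (p * (a + b) / 2)"
  proof -
    have "(exp (a * (p / 2)))\<^sup>2 = exp (p * a)" "(exp (b * (p / 2)))\<^sup>2 = exp (p * b)"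
      "exp (a * (p / 2)) * exp (b * (p / 2)) = exp (p * (a + b) / 2)"
      unfolding power2_eq_square mult_exp_exp exp_inj_iff by (simp_all add: field_simps)
    then show ?thesis unfolding u v power2_diff exp_powr_real by simp
  qed
  then have L: "(u powr (p / 2) - v powr (p / 2))\<^sup>2 = 2 * G * (cosh (p * z) - 1)"
    unfolding eqs G by (simp add: cosh_field_def algebra_simps)
  have "(u - v) * (u powr (p - 1) - v powr (p - 1))
      = exp (p * a) + exp (p * b) - exp (a + (p - 1) * b) - exp (b + (p - 1) * a)"
    by (simp add: u v exp_powr_real algebra_simps mult_exp_exp)
  then have R: "(u - v) * (u powr (p - 1) - v powr (p - 1)) = 2 * G * (cosh (p * z) - cosh ((p - 2) * z))"
    unfolding eqs cosh_field_def by (simp add: field_simps)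
  have "4 * (p - 1) * (cosh (p * z) - 1) \<le> p\<^sup>2 * (cosh (p * z) - cosh ((p - 2) * z))"
    using cosh_minus_1_le[OF assms(3), of z] by (simp add: power2_eq_square algebra_simps)
  then have "2 * G * (4 * (p - 1) * (cosh (p * z) - 1)) \<le> 2 * G * (p\<^sup>2 * (cosh (p * z) - cosh ((p - 2) * z)))"
    by (intro mult_left_mono) (auto simp: G_def)
  then show ?thesis unfolding L R by (simp only: ac_simps)
qed

text \<open>
  Both sides vanish at 0 together with their first derivatives; the second derivative of the
  difference is \<open>2 (1 - y\<^sup>2)\<^bsup>-3/2\<^esup> - 2 (1 - y\<^sup>2)\<^bsup>-1\<^esup> \<ge> 0\<close>.
\<close>

lemma binary_relative_entropy_le:
  fixes y :: real
  assumes "0 \<le> y" "y < 1"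
  shows "(1 + y) * ln (1 + y) + (1 - y) * ln (1 - y) \<le> 2 * (1 - sqrt (1 - y\<^sup>2))"
proof -
  have pos: "0 < 1 - t\<^sup>2" if "0 \<le> t" "t \<le> y" for t
    using that assms by (simp add: power2_eq_square) (smt (verit) mult_left_le_one_le)
  have dsqrt: "((\<lambda>x. sqrt (1 - x\<^sup>2)) has_real_derivative - t / sqrt (1 - t\<^sup>2)) (at t)"
    if "0 < 1 - t\<^sup>2" for t :: real
  proof -
    have "((\<lambda>x. 1 - x\<^sup>2) has_real_derivative - (2 * t)) (at t)"
      by (auto intro!: derivative_eq_intros)
    from DERIV_chain2[OF DERIV_real_sqrt[OF that] this] show ?thesis
      by (simp add: field_simps)
  qed
  have D1: "2 * 0 / sqrt (1 - 0\<^sup>2) - (ln (1 + 0) - ln (1 - 0)) \<le> 2 * x / sqrt (1 - x\<^sup>2) - (ln (1 + x) - ln (1 - x))"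
    if x: "0 \<le> x" "x \<le> y" for x :: real
  proof (rule DERIV_nonneg_imp_nondecreasing[OF x(1)])
    fix t assume t: "0 \<le> t" "t \<le> x"
    with x pos[of t] assms have p: "0 < 1 - t\<^sup>2" "t < 1" by auto
    let ?s = "sqrt (1 - t\<^sup>2)"
    have s: "0 < ?s" "?s\<^sup>2 = 1 - t\<^sup>2" "?s \<le> 1" using p by auto
    have d1: "((\<lambda>x. sqrt (1 - x\<^sup>2)) has_real_derivative - t / ?s) (at t)"
      by (rule dsqrt[OF p(1)])
    have d2: "((\<lambda>x. 2 * x) has_real_derivative 2) (at t)"
      by (auto intro!: derivative_eq_intros)
    have d3: "((\<lambda>x. ln (1 + x) - ln (1 - x)) has_real_derivative 1 / (1 + t) + 1 / (1 - t)) (at t)"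
      using p t by (auto intro!: derivative_eq_intros)
    have "((\<lambda>x. 2 * x / sqrt (1 - x\<^sup>2) - (ln (1 + x) - ln (1 - x))) has_real_derivative
       (2 * ?s - 2 * t * (- t / ?s)) / ?s\<^sup>2 - (1 / (1 + t) + 1 / (1 - t))) (at t)"
      using DERIV_diff[OF DERIV_divide[OF d2 d1] d3] s unfolding power2_eq_square by simp
    moreover have "(2 * ?s - 2 * t * (- t / ?s)) / ?s\<^sup>2 - (1 / (1 + t) + 1 / (1 - t)) = 2 / ?s ^ 3 - 2 / ?s\<^sup>2"
    proof -
      have "(2 * ?s - 2 * t * (- t / ?s)) = (2 * (?s\<^sup>2 + t\<^sup>2)) / ?s"
        using s(1) by (simp add: field_simps power2_eq_square)
      also have "\<dots> = 2 / ?s" using s by simp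
      finally have "(2 * ?s - 2 * t * (- t / ?s)) / ?s\<^sup>2 = 2 / ?s ^ 3"
        by (simp add: power2_eq_square power3_eq_cube)
      moreover have "1 / (1 + t) + 1 / (1 - t) = 2 / ?s\<^sup>2"
        unfolding s(2) using t p by (simp add: field_simps power2_eq_square)
      ultimately show ?thesis by simp
    qed
    moreover have "2 / ?s\<^sup>2 \<le> 2 / ?s ^ 3"
      using s power_decreasing[of 2 3 ?s] by (intro frac_le) auto
    ultimately show "\<exists>d. ((\<lambda>x. 2 * x / sqrt (1 - x\<^sup>2) - (ln (1 + x) - ln (1 - x))) has_real_derivative d) (at t) \<and> 0 \<le> d"
      by auto
  qed
  let ?F = "\<lambda>y::real. 2 * (1 - sqrt (1 - y\<^sup>2)) - ((1 + y) * ln (1 + y) + (1 - y) * ln (1 - y))"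
  have "?F 0 \<le> ?F y"
  proof (rule DERIV_nonneg_imp_nondecreasing[OF assms(1)])
    fix x assume x: "0 \<le> x" "x \<le> y"
    with pos[of x] assms have p: "0 < 1 - x\<^sup>2" "x < 1" by auto
    have "(?F has_real_derivative 2 * x / sqrt (1 - x\<^sup>2) - (ln (1 + x) - ln (1 - x))) (at x)"
    proof -
      have "((\<lambda>x. (1 + x) * ln (1 + x) + (1 - x) * ln (1 - x)) has_real_derivative
          ln (1 + x) - ln (1 - x)) (at x)"
        using p x by (auto intro!: derivative_eq_intros)
      from DERIV_diff[OF DERIV_cmult[OF DERIV_diff[OF DERIV_const[of 1] dsqrt[OF p(1)]], of 2] this]
      show ?thesis by simp
    qed
    then show "\<exists>d. (?F has_real_derivative d) (at x) \<and> 0 \<le> d"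
      using D1[OF x] by auto
  qed
  then show ?thesis by simp
qed

text \<open>
  Both sides are homogeneous of degree one, so it suffices to treat \<open>A = 1 + y\<close>, \<open>B = 1 - y\<close>.
\<close>

lemma two_point_log_sobolev:
  fixes A B :: real
  assumes "0 < B" "B \<le> A"
  shows "(A * ln A + B * ln B) / 2 - (A + B) / 2 * ln ((A + B) / 2) \<le> (sqrt A - sqrt B)\<^sup>2 / 2"
proof -
  define s y where "s = (A + B) / 2" and "y = (A - B) / (A + B)"
  have s: "0 < s" and A: "A = s * (1 + y)" and B: "B = s * (1 - y)" and y: "0 \<le> y" "y < 1"
    using assms by (auto simp: s_def y_def field_simps)
  have "sqrt A * sqrt B = s * sqrt (1 - y\<^sup>2)"
  proof -
    have "sqrt A * sqrt B = sqrt (s\<^sup>2 * (1 - y\<^sup>2))"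
      unfolding A B real_sqrt_mult[symmetric] by (simp add: power2_eq_square algebra_simps)
    then show ?thesis using s by (simp add: real_sqrt_mult)
  qed
  moreover have "(sqrt A - sqrt B)\<^sup>2 = A + B - 2 * (sqrt A * sqrt B)"
    using assms by (simp add: power2_diff)
  ultimately have R: "(sqrt A - sqrt B)\<^sup>2 / 2 = s * (1 - sqrt (1 - y\<^sup>2))"
    by (simp add: s_def field_simps)
  have "(A * ln A + B * ln B) / 2 - s * ln s
      = s / 2 * ((1 + y) * ln (1 + y) + (1 - y) * ln (1 - y))"
  proof -
    have "ln A = ln s + ln (1 + y)" "ln B = ln s + ln (1 - y)"
      unfolding A B using s y by (simp_all add: ln_mult)
    then show ?thesis unfolding A B by (simp add: algebra_simps add_divide_distrib diff_divide_distrib)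
  qed
  also have "\<dots> \<le> s / 2 * (2 * (1 - sqrt (1 - y\<^sup>2)))"
    using s y by (intro mult_left_mono binary_relative_entropy_le) auto
  finally show ?thesis unfolding R unfolding s_def by linarith
qed

text \<open>
  The logarithmic Sobolev inequality for \<open>L\<^sup>p\<close>: apply the one for \<open>L\<^sup>2\<close> to the values
  \<open>u\<^bsup>p/2\<^esup>\<close> and \<open>v\<^bsup>p/2\<^esup>\<close>, and bound their energy by the Stroock-Varopoulos inequality.
\<close>

lemma entropy_le_energy:
  fixes u v p :: real
  assumes "0 < v" "v \<le> u" "1 < p"
  shows "(u powr p * ln (u powr p) + v powr p * ln (v powr p)) / 2
           - (u powr p + v powr p) / 2 * ln ((u powr p + v powr p) / 2)
       \<le> p\<^sup>2 / (8 * (p - 1)) * ((u - v) * (u powr (p - 1) - v powr (p - 1)))"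
proof -
  have sq: "sqrt (u powr p) = u powr (p / 2)" "sqrt (v powr p) = v powr (p / 2)"
    by (simp_all add: powr_half_sqrt[symmetric] powr_powr)
  have "(u powr (p / 2) - v powr (p / 2))\<^sup>2 / 2
      \<le> p\<^sup>2 / (8 * (p - 1)) * ((u - v) * (u powr (p - 1) - v powr (p - 1)))"
    using stroock_varopoulos[of u v p] assms by (simp add: field_simps)
  moreover have "v powr p \<le> u powr p"
    using assms by (intro powr_mono2) auto
  moreover have "0 < v powr p" using assms by simp
  ultimately show ?thesis
    using two_point_log_sobolev[of "v powr p" "u powr p"] unfolding sq by linarith
qed

definition power_mean :: "real \<Rightarrow> real \<Rightarrow> real \<Rightarrow> real" where
  "power_mean p a b = ((a powr p + b powr p) / 2) powr (1 / p)"

text \<open>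
  Gross's argument. The noisy function \<open>1 \<plusminus> c / sqrt (p - 1)\<close> is followed along the curve on which
  the exponent \<open>p\<close> grows while the noise rate \<open>1 / sqrt (p - 1)\<close> falls. The derivative of
  the logarithm of its \<open>p\<close>-norm is, up to the positive factor \<open>1 / (p\<^sup>2 E)\<close>, the entropy of
  the \<open>p\<close>-th power minus the energy term of \<open>entropy_le_energy\<close>. On the open interval
  the amplitude stays below 1, so both values of the function are positive there; at the left
  end one of them may vanish, and there continuity suffices.
\<close>

lemma power_mean_noise_decreasing:
  fixes c q P :: real
  assumes q: "1 < q" "q \<le> P" and c: "0 \<le> c" "c \<le> sqrt (q - 1)"
  shows "power_mean P (1 + c / sqrt (P - 1)) (1 - c / sqrt (P - 1))
       \<le> power_mean q (1 + c / sqrt (q - 1)) (1 - c / sqrt (q - 1))"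
proof (cases "q = P")
  case False
  then have "q < P" using q by simp
  define w where "w p = c / sqrt (p - 1)" for p
  define E where "E p = ((1 + w p) powr p + (1 - w p) powr p) / 2" for p
  define L where "L p = ln (E p) / p" for p
  have w: "0 \<le> w p" "w p \<le> 1" if "q \<le> p" for p
  proof -
    have "c \<le> sqrt (p - 1)" using c that by (meson diff_right_mono order_trans real_sqrt_le_mono)
    then show "0 \<le> w p" "w p \<le> 1" using q that c by (auto simp: w_def)
  qed
  have w1: "w p < 1" if "q < p" for p
  proof -
    have "c < sqrt (p - 1)" using c that by (smt (verit) real_sqrt_less_mono)
    then show ?thesis using q that c by (simp add: w_def)
  qed
  have Epos: "0 < E p" if "q \<le> p" for p
    using w[OF that] by (simp add: E_def add_pos_nonneg)
  have "L P \<le> L q"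
  proof (rule DERIV_nonpos_imp_decreasing_open[OF q(2)])
    fix p assume p: "q < p" "p < P"
    define u v where "u = 1 + w p" and "v = 1 - w p"
    have uv: "0 < v" "v \<le> u" using w[of p] w1[of p] p by (auto simp: u_def v_def)
    define w' where "w' = - w p / (2 * (p - 1))"
    have dw: "(w has_real_derivative w') (at p)"
    proof -
      have "((\<lambda>p. sqrt (p - 1)) has_real_derivative 1 / (2 * sqrt (p - 1))) (at p)"
        using p q by (auto intro!: derivative_eq_intros simp: field_simps)
      from DERIV_divide[OF DERIV_const[of c] this] p q show ?thesis
        unfolding w_def[abs_def] w'_def by (simp add: field_simps)
    qed
    \<comment> \<open>The derivative of the logarithm of the norm at \<open>p\<close>, in the two values \<open>u\<close> and \<open>v\<close>.\<close>
    have dA: "((\<lambda>p. (1 + w p) powr p) has_real_derivative u powr p * (1 * ln u + w' * p / u)) (at p)"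
      unfolding u_def by (rule DERIV_powr) (use uv dw in \<open>auto intro!: derivative_eq_intros simp: u_def v_def\<close>)
    have dB: "((\<lambda>p. (1 - w p) powr p) has_real_derivative v powr p * (1 * ln v + (- w') * p / v)) (at p)"
      unfolding v_def by (rule DERIV_powr) (use uv dw in \<open>auto intro!: derivative_eq_intros simp: u_def v_def\<close>)
    define E' where "E' = (u powr p * (1 * ln u + w' * p / u) + v powr p * (1 * ln v + (- w') * p / v)) / 2"
    have dE: "(E has_real_derivative E') (at p)"
      unfolding E_def[abs_def] E'_def by (intro DERIV_cdivide DERIV_add dA dB)
    have dL: "(L has_real_derivative (E' / E p * p - ln (E p) * 1) / (p * p)) (at p)"
      unfolding L_def[abs_def]
      by (rule DERIV_divide) (use dE Epos[of p] p q in \<open>auto intro!: derivative_eq_intros\<close>)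
    have E: "E p = (u powr p + v powr p) / 2" by (simp add: E_def u_def v_def)
    have "u powr p / u = u powr (p - 1)" "v powr p / v = v powr (p - 1)"
      using uv by (simp_all add: powr_diff)
    moreover have "E' * p = (u powr p * (p * ln u) + v powr p * (p * ln v)) / 2
        + p\<^sup>2 * w' / 2 * (u powr p / u - v powr p / v)"
      unfolding E'_def by (simp add: algebra_simps power2_eq_square add_divide_distrib diff_divide_distrib)
    ultimately have "E' * p = (u powr p * (p * ln u) + v powr p * (p * ln v)) / 2
        + p\<^sup>2 * w' / 2 * (u powr (p - 1) - v powr (p - 1))"
      by simp
    also have "\<dots> = (u powr p * ln (u powr p) + v powr p * ln (v powr p)) / 2
        - p\<^sup>2 / (8 * (p - 1)) * ((u - v) * (u powr (p - 1) - v powr (p - 1)))"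
    proof -
      have "p\<^sup>2 * w' / 2 = - (p\<^sup>2 / (8 * (p - 1)) * (u - v))"
        using p q by (simp add: w'_def u_def v_def field_simps)
      moreover have "ln (u powr p) = p * ln u" "ln (v powr p) = p * ln v"
        using uv by (simp_all add: ln_powr)
      ultimately show ?thesis
        by (simp only: mult_minus_left mult.assoc add_uminus_conv_diff)
    qed
    also have "\<dots> \<le> E p * ln (E p)"
      using entropy_le_energy[OF uv, of p] p q unfolding E by linarith
    finally have "E' * p \<le> E p * ln (E p)" .
    then have "E' / E p * p \<le> ln (E p)"
      using Epos[of p] p by (simp add: field_simps)
    then have "(E' / E p * p - ln (E p) * 1) / (p * p) \<le> 0"
      by (intro divide_nonpos_nonneg) auto
    with dL show "\<exists>y. (L has_real_derivative y) (at p) \<and> y \<le> 0" by blast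
  next
    have cw: "continuous_on {q..P} w"
      unfolding w_def[abs_def] using q by (auto intro!: continuous_intros)
    have "continuous_on {q..P} (\<lambda>p. (1 + w p) powr p)" "continuous_on {q..P} (\<lambda>p. (1 - w p) powr p)"
      by (rule continuous_on_powr'; use w q in \<open>auto intro!: continuous_intros cw\<close>)+
    then have "continuous_on {q..P} E"
      unfolding E_def[abs_def] by (intro continuous_on_divide continuous_on_add continuous_on_const) auto
    moreover have "\<forall>p\<in>{q..P}. E p \<noteq> 0"
      using Epos by (metis atLeastAtMost_iff less_irrefl)
    ultimately show "continuous_on {q..P} L"
      unfolding L_def[abs_def] using q by (intro continuous_intros) auto
  qed
  moreover have "power_mean p (1 + c / sqrt (p - 1)) (1 - c / sqrt (p - 1)) = exp (L p)" if "q \<le> p" for p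
    using Epos[OF that] by (simp add: power_mean_def L_def E_def w_def powr_def)
  ultimately show ?thesis using q by simp
qed simp

lemma power_mean_scale:
  assumes "0 \<le> m" "0 \<le> a" "0 \<le> b" "p \<noteq> 0"
  shows "power_mean p (m * a) (m * b) = m * power_mean p a b"
proof -
  have "((m * a) powr p + (m * b) powr p) / 2 = m powr p * ((a powr p + b powr p) / 2)"
    using assms by (simp add: powr_mult field_simps)
  then show ?thesis
    unfolding power_mean_def using assms by (simp only: powr_mult powr_powr) simp
qed

lemma power_mean_commute: "power_mean p a b = power_mean p b a"
  by (simp only: power_mean_def add.commute)

text \<open>
  The Bonami inequality for one bit: after scaling the mean to 1, the value \<open>1 + d\<close> turns into
  \<open>1 + \<rho> d\<close>, and with \<open>c = d sqrt (q - 1)\<close> these are the two ends of the curve just studied.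
\<close>

lemma two_point_hypercontractive:
  fixes q P \<rho> y1 y2 :: real
  assumes q: "1 < q" "q \<le> P" and \<rho>: "0 \<le> \<rho>" "\<rho>\<^sup>2 * (P - 1) = q - 1" and y: "0 \<le> y1" "0 \<le> y2"
  shows "power_mean P ((1 + \<rho>) / 2 * y1 + (1 - \<rho>) / 2 * y2) ((1 - \<rho>) / 2 * y1 + (1 + \<rho>) / 2 * y2)
       \<le> power_mean q y1 y2"
  using y
proof (induction y1 y2 rule: linorder_wlog)
  case (sym a b)
  from sym(1)[OF sym(3,2)] show ?case
    by (subst (1 2) power_mean_commute) (simp add: add.commute)
next
  case (le y2 y1)
  define m d where "m = (y1 + y2) / 2" and "d = (y1 - y2) / (y1 + y2)"
  show ?case
  proof (cases "y1 = 0")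
    case True
    then show ?thesis using le by (simp add: power_mean_def)
  next
    case False
    then have m: "0 < m" "y1 = m * (1 + d)" "y2 = m * (1 - d)" "0 \<le> d" "d \<le> 1"
      using le by (auto simp: m_def d_def field_simps)
    have \<rho>_eq: "\<rho> = sqrt (q - 1) / sqrt (P - 1)"
      using q \<rho> by (simp add: real_sqrt_mult flip: \<rho>(2))
    then have "\<rho> \<le> 1" using q by simp
    have d: "d * sqrt (q - 1) / sqrt (P - 1) = \<rho> * d" "d * sqrt (q - 1) / sqrt (q - 1) = d"
      using q by (simp_all add: \<rho>_eq)
    have "power_mean P (1 + \<rho> * d) (1 - \<rho> * d) \<le> power_mean q (1 + d) (1 - d)"
      using power_mean_noise_decreasing[of q P "d * sqrt (q - 1)"] q m d
      by (simp add: mult_left_le_one_le)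
    then have "power_mean P (m * (1 + \<rho> * d)) (m * (1 - \<rho> * d)) \<le> power_mean q (m * (1 + d)) (m * (1 - d))"
      using m q \<rho> \<open>\<rho> \<le> 1\<close> by (simp add: power_mean_scale mult_le_one)
    moreover have "m * (1 + \<rho> * d) = (1 + \<rho>) / 2 * y1 + (1 - \<rho>) / 2 * y2"
      "m * (1 - \<rho> * d) = (1 - \<rho>) / 2 * y1 + (1 + \<rho>) / 2 * y2"
      unfolding m(2,3) by (simp_all add: field_simps)
    ultimately show ?thesis
      using m(2,3) by (subst (1 2) power_mean_commute) (simp add: add.commute)
  qed
qed

lemma power_mean_nonneg: "0 \<le> power_mean p a b"
  by (simp add: power_mean_def)

lemma power_mean_powr:
  assumes "p \<noteq> 0"
  shows "power_mean p a b powr p = (a powr p + b powr p) / 2"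
  unfolding power_mean_def powr_powr using assms by simp

lemma power_mean_Holder:
  fixes p P :: real
  assumes p: "1 < p" "1 < P" "1 / p + 1 / P = 1"
    and nn: "0 \<le> x1" "0 \<le> x2" "0 \<le> z1" "0 \<le> z2"
  shows "(x1 * z1 + x2 * z2) / 2 \<le> power_mean p x1 x2 * power_mean P z1 z2"
proof -
  define X Z where "X = power_mean p x1 x2" and "Z = power_mean P z1 z2"
  have nX: "0 \<le> X" "0 \<le> Z" by (simp_all add: X_def Z_def power_mean_nonneg)
  have eX: "X powr p = (x1 powr p + x2 powr p) / 2" "Z powr P = (z1 powr P + z2 powr P) / 2"
    using p by (simp_all add: X_def Z_def power_mean_powr)
  show ?thesis
  proof (cases "X = 0 \<or> Z = 0")
    case True
    then have "(x1 = 0 \<and> x2 = 0) \<or> (z1 = 0 \<and> z2 = 0)"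
      using eX p nn by (auto simp: add_nonneg_eq_0_iff)
    then show ?thesis using nX by (auto simp: X_def Z_def)
  next
    case False
    then have pos: "0 < X" "0 < Z" using nX by auto
    have Y: "x / X * (z / Z) \<le> x powr p / X powr p / p + z powr P / Z powr P / P"
      if "0 \<le> x" "0 \<le> z" for x z
      using Youngs_inequality[OF p, of "x / X" "z / Z"] that pos by (simp add: powr_divide)
    have "(x1 / X * (z1 / Z) + x2 / X * (z2 / Z)) / 2
       \<le> ((x1 powr p + x2 powr p) / 2) / X powr p / p + ((z1 powr P + z2 powr P) / 2) / Z powr P / P"
    proof -
      have "((x1 powr p + x2 powr p) / 2) / X powr p / p + ((z1 powr P + z2 powr P) / 2) / Z powr P / P
        = ((x1 powr p / X powr p / p + z1 powr P / Z powr P / P)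
            + (x2 powr p / X powr p / p + z2 powr P / Z powr P / P)) / 2"
        by (simp add: add_divide_distrib)
      then show ?thesis
        by (simp only:) (intro divide_right_mono add_mono Y nn, simp)
    qed
    also have "\<dots> = 1"
      unfolding eX[symmetric] using pos p by simp
    finally show ?thesis
      using pos by (simp add: field_simps flip: X_def Z_def)
  qed
qed

text \<open>
  Hoelder's inequality with the conjugate exponent \<open>P = p / (p - 1)\<close> of \<open>p\<close> puts the noise on one function
  only; as \<open>P - 1 = 1 / (p - 1)\<close>, the condition \<open>(p - 1) (q - 1) = \<rho>\<^sup>2\<close> is precisely the
  one under which the noise operator contracts from \<open>q\<close> to \<open>P\<close>.
\<close>

lemma two_function_hypercontractive_bit:
  fixes p q \<rho> :: real
  assumes p: "1 < p" and q: "1 < q" and \<rho>: "0 < \<rho>" "\<rho> < 1" "(p - 1) * (q - 1) = \<rho>\<^sup>2"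
    and nn: "0 \<le> x1" "0 \<le> x2" "0 \<le> y1" "0 \<le> y2"
  shows "(x1 * ((1 + \<rho>) / 2 * y1 + (1 - \<rho>) / 2 * y2) + x2 * ((1 - \<rho>) / 2 * y1 + (1 + \<rho>) / 2 * y2)) / 2
       \<le> power_mean p x1 x2 * power_mean q y1 y2"
proof -
  define P where "P = p / (p - 1)"
  have P: "1 < P" "1 / p + 1 / P = 1" "P - 1 = 1 / (p - 1)"
    using p by (auto simp: P_def field_simps)
  have r: "\<rho>\<^sup>2 * (P - 1) = q - 1"
    unfolding P \<rho>(3)[symmetric] using p by simp
  have "\<rho>\<^sup>2 * (P - 1) \<le> 1 * (P - 1)"
    using \<rho> P(1) by (intro mult_right_mono) (auto simp: power_le_one)
  then have "q \<le> P" using r by simp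
  have "(x1 * ((1 + \<rho>) / 2 * y1 + (1 - \<rho>) / 2 * y2) + x2 * ((1 - \<rho>) / 2 * y1 + (1 + \<rho>) / 2 * y2)) / 2
      \<le> power_mean p x1 x2
          * power_mean P ((1 + \<rho>) / 2 * y1 + (1 - \<rho>) / 2 * y2) ((1 - \<rho>) / 2 * y1 + (1 + \<rho>) / 2 * y2)"
    using p P nn \<rho> by (intro power_mean_Holder) auto
  also have "\<dots> \<le> power_mean p x1 x2 * power_mean q y1 y2"
    using two_point_hypercontractive[OF q \<open>q \<le> P\<close> _ r nn(3,4)] \<rho>
    by (intro mult_left_mono power_mean_nonneg) auto
  finally show ?thesis .
qed

section \<open>The noise operator on subcubes\<close>

text \<open>
  The index set is arbitrary, so that one can induct on it and restrict a function on the
  cube to the two facets orthogonal to a coordinate.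
\<close>

definition subcube :: "nat set \<Rightarrow> (nat \<Rightarrow> int) set" where
  "subcube I = PiE I (\<lambda>_. {-1, 1})"

definition cube_avg :: "nat set \<Rightarrow> ((nat \<Rightarrow> int) \<Rightarrow> real) \<Rightarrow> real" where
  "cube_avg I F = (\<Sum>x\<in>subcube I. F x) / 2 ^ card I"

definition noise_kernel :: "real \<Rightarrow> nat set \<Rightarrow> (nat \<Rightarrow> int) \<Rightarrow> (nat \<Rightarrow> int) \<Rightarrow> real" where
  "noise_kernel \<rho> I x y = (\<Prod>i\<in>I. if y i = x i then (1 + \<rho>) / 2 else (1 - \<rho>) / 2)"

definition noise :: "real \<Rightarrow> nat set \<Rightarrow> ((nat \<Rightarrow> int) \<Rightarrow> real) \<Rightarrow> (nat \<Rightarrow> int) \<Rightarrow> real" where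
  "noise \<rho> I f x = (\<Sum>y\<in>subcube I. noise_kernel \<rho> I x y * f y)"

lemma finite_subcube [simp]: "finite I \<Longrightarrow> finite (subcube I)"
  by (simp add: subcube_def finite_PiE)

lemma card_subcube: "finite I \<Longrightarrow> card (subcube I) = 2 ^ card I"
  by (simp add: subcube_def card_PiE numeral_2_eq_2)

lemma subcube_empty [simp]: "subcube {} = {\<lambda>_. undefined}"
  by (simp add: subcube_def)

lemma upd_in_subcube: "x \<in> subcube I \<Longrightarrow> s \<in> {-1, 1} \<Longrightarrow> x(i := s) \<in> subcube (insert i I)"
  unfolding subcube_def by (auto simp: PiE_iff extensional_def)

lemma sum_subcube_insert:
  assumes "i \<notin> I"
  shows "(\<Sum>x\<in>subcube (insert i I). F x) = (\<Sum>x\<in>subcube I. F (x(i := 1)) + F (x(i := -1)))"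
proof -
  have "(\<Sum>x\<in>subcube (insert i I). F x) = (\<Sum>(s, x)\<in>{-1, 1} \<times> subcube I. F (x(i := s)))"
    unfolding subcube_def PiE_insert_eq
    by (subst sum.reindex[OF inj_combinator[OF assms]]) (simp add: case_prod_beta)
  also have "\<dots> = (\<Sum>s\<in>{-1, 1}. \<Sum>x\<in>subcube I. F (x(i := s)))"
    by (simp add: sum.cartesian_product)
  also have "\<dots> = (\<Sum>x\<in>subcube I. F (x(i := 1)) + F (x(i := -1)))"
    by (simp add: sum.distrib add.commute)
  finally show ?thesis .
qed

lemma cube_avg_insert:
  assumes "finite I" "i \<notin> I"
  shows "cube_avg (insert i I) F = (cube_avg I (\<lambda>x. F (x(i := 1))) + cube_avg I (\<lambda>x. F (x(i := -1)))) / 2"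
  using assms by (simp add: cube_avg_def sum_subcube_insert sum.distrib field_simps)

lemma noise_kernel_insert:
  assumes "finite I" "i \<notin> I"
  shows "noise_kernel \<rho> (insert i I) (x(i := s)) (y(i := t))
       = (if t = s then (1 + \<rho>) / 2 else (1 - \<rho>) / 2) * noise_kernel \<rho> I x y"
proof -
  have "(\<Prod>j\<in>I. if (y(i := t)) j = (x(i := s)) j then (1 + \<rho>) / 2 else (1 - \<rho>) / 2) = noise_kernel \<rho> I x y"
    unfolding noise_kernel_def using assms by (intro prod.cong) auto
  then show ?thesis
    using assms by (simp add: noise_kernel_def)
qed

text \<open>
  The noise acts on the coordinate \<open>i\<close> independently of the others, hence on a facet the noisy
  function is the mixture of the two noisy restrictions with weights \<open>(1 \<plusminus> \<rho>) / 2\<close>.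
\<close>

lemma noise_insert:
  assumes "finite I" "i \<notin> I"
  shows "noise \<rho> (insert i I) f (x(i := 1))
       = (1 + \<rho>) / 2 * noise \<rho> I (\<lambda>x. f (x(i := 1))) x + (1 - \<rho>) / 2 * noise \<rho> I (\<lambda>x. f (x(i := -1))) x"
    and "noise \<rho> (insert i I) f (x(i := -1))
       = (1 - \<rho>) / 2 * noise \<rho> I (\<lambda>x. f (x(i := 1))) x + (1 + \<rho>) / 2 * noise \<rho> I (\<lambda>x. f (x(i := -1))) x"
  unfolding noise_def sum_subcube_insert[OF assms(2)] noise_kernel_insert[OF assms]
  by (simp_all add: sum.distrib sum_distrib_left mult.assoc del: sum_divide_distrib)

lemma cube_avg_add: "cube_avg I (\<lambda>x. F x + G x) = cube_avg I F + cube_avg I G"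
  by (simp add: cube_avg_def sum.distrib add_divide_distrib)

lemma cube_avg_diff: "cube_avg I (\<lambda>x. F x - G x) = cube_avg I F - cube_avg I G"
  by (simp add: cube_avg_def sum_subtractf diff_divide_distrib)

lemma cube_avg_cmult: "cube_avg I (\<lambda>x. c * F x) = c * cube_avg I F"
  by (simp add: cube_avg_def flip: sum_distrib_left)

lemma cube_avg_const: "finite I \<Longrightarrow> cube_avg I (\<lambda>_. c) = c"
  by (simp add: cube_avg_def card_subcube)

lemma cube_avg_mono:
  assumes "\<And>x. x \<in> subcube I \<Longrightarrow> F x \<le> G x"
  shows "cube_avg I F \<le> cube_avg I G"
  unfolding cube_avg_def by (intro divide_right_mono sum_mono assms) auto

lemma cube_avg_cong:
  assumes "\<And>x. x \<in> subcube I \<Longrightarrow> F x = G x"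
  shows "cube_avg I F = cube_avg I G"
  using assms by (simp add: cube_avg_def)

lemma cube_avg_nonneg:
  assumes "\<And>x. x \<in> subcube I \<Longrightarrow> 0 \<le> F x"
  shows "0 \<le> cube_avg I F"
  unfolding cube_avg_def by (intro divide_nonneg_nonneg sum_nonneg assms) auto

lemma noise_const:
  assumes "finite I" "x \<in> subcube I"
  shows "noise \<rho> I (\<lambda>_. c) x = c"
proof -
  have "(\<Sum>y\<in>subcube I. noise_kernel \<rho> I x y)
      = (\<Prod>i\<in>I. \<Sum>s\<in>{-1, 1}. if s = x i then (1 + \<rho>) / 2 else (1 - \<rho>) / 2)"
    unfolding noise_kernel_def subcube_def using assms by (subst prod_sum_PiE) auto
  also have "\<dots> = 1"
  proof (rule prod.neutral, safe)
    fix i assume "i \<in> I"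
    then have "x i = -1 \<or> x i = 1"
      using assms(2) by (auto simp: subcube_def PiE_iff)
    then show "(\<Sum>s\<in>{-1, 1}. if s = x i then (1 + \<rho>) / 2 else (1 - \<rho>) / 2) = 1"
      by (auto simp: field_simps)
  qed
  finally show ?thesis
    by (simp add: noise_def flip: sum_distrib_right)
qed

lemma cube_avg_noise: "finite I \<Longrightarrow> cube_avg I (noise \<rho> I f) = cube_avg I f"
proof (induction I arbitrary: f rule: finite_induct)
  case empty
  then show ?case by (simp add: noise_def noise_kernel_def cube_avg_def)
next
  case (insert i I)
  define c c' where cc: "c = (1 + \<rho>) / 2" "c' = (1 - \<rho>) / 2"
  have "c * s + c' * t + (c' * s + c * t) = s + t" for s t
    by (simp add: cc field_simps)
  then show ?case
    unfolding cube_avg_insert[OF insert.hyps] noise_insert[OF insert.hyps] cc[symmetric]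
    by (simp add: cube_avg_add cube_avg_cmult insert.IH)
qed

lemma noise_diff: "noise \<rho> I (\<lambda>x. F x - G x) x = noise \<rho> I F x - noise \<rho> I G x"
  by (simp add: noise_def sum_subtractf right_diff_distrib)

lemma noise_kernel_nonneg: "0 \<le> \<rho> \<Longrightarrow> \<rho> \<le> 1 \<Longrightarrow> 0 \<le> noise_kernel \<rho> I x y"
  unfolding noise_kernel_def by (intro prod_nonneg) auto

lemma noise_mono:
  assumes "0 \<le> \<rho>" "\<rho> \<le> 1" "\<And>x. x \<in> subcube I \<Longrightarrow> F x \<le> G x"
  shows "noise \<rho> I F x \<le> noise \<rho> I G x"
  unfolding noise_def using assms by (intro sum_mono mult_left_mono noise_kernel_nonneg) auto

text \<open>
  Tensorization. Conditioning on one coordinate, the induction hypothesis bounds the correlations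
  of the restrictions by products of their norms; these norms, as functions of that single bit, are
  then subject to the inequality on two points.
\<close>

theorem two_function_hypercontractive:
  fixes p q \<rho> :: real
  assumes p: "1 < p" and q: "1 < q" and \<rho>: "0 < \<rho>" "\<rho> < 1" "(p - 1) * (q - 1) = \<rho>\<^sup>2"
    and "finite I"
    and "\<And>x. x \<in> subcube I \<Longrightarrow> 0 \<le> f x" "\<And>x. x \<in> subcube I \<Longrightarrow> 0 \<le> g x"
  shows "cube_avg I (\<lambda>x. f x * noise \<rho> I g x)
       \<le> cube_avg I (\<lambda>x. f x powr p) powr (1 / p) * cube_avg I (\<lambda>x. g x powr q) powr (1 / q)"
  using assms(6-8)
proof (induction I arbitrary: f g rule: finite_induct)
  case empty
  then show ?case using p q
    by (simp add: cube_avg_def noise_def noise_kernel_def powr_powr)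
next
  case (insert i I)
  define f1 f2 g1 g2 where "f1 = (\<lambda>x. f (x(i := 1)))" "f2 = (\<lambda>x. f (x(i := -1)))"
    "g1 = (\<lambda>x. g (x(i := 1)))" "g2 = (\<lambda>x. g (x(i := -1)))"
  note defs = this
  define S where "S u v = cube_avg I (\<lambda>x. u x * noise \<rho> I v x)" for u v
  define X where "X u = cube_avg I (\<lambda>x. u x powr p) powr (1 / p)" for u
  define Y where "Y v = cube_avg I (\<lambda>x. v x powr q) powr (1 / q)" for v
  have nn: "0 \<le> f1 x" "0 \<le> f2 x" "0 \<le> g1 x" "0 \<le> g2 x" if "x \<in> subcube I" for x
    using insert.prems upd_in_subcube[OF that] by (auto simp: defs)
  have S: "S u v \<le> X u * Y v" if "u \<in> {f1, f2}" "v \<in> {g1, g2}" for u v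
    using insert.IH[of u v] nn that unfolding S_def X_def Y_def by auto
  define c c' where cc: "c = (1 + \<rho>) / 2" "c' = (1 - \<rho>) / 2"
  have *: "cube_avg (insert i I) (\<lambda>x. f x * noise \<rho> (insert i I) g x)
      = ((1 + \<rho>) / 2 * S f1 g1 + (1 - \<rho>) / 2 * S f1 g2 + ((1 - \<rho>) / 2 * S f2 g1 + (1 + \<rho>) / 2 * S f2 g2)) / 2"
    unfolding cube_avg_insert[OF insert.hyps] noise_insert[OF insert.hyps] S_def
      defs cc[symmetric] cube_avg_cmult[symmetric] cube_avg_add[symmetric]
    by (simp add: algebra_simps)
  also have "\<dots> \<le> ((1 + \<rho>) / 2 * (X f1 * Y g1) + (1 - \<rho>) / 2 * (X f1 * Y g2)
      + ((1 - \<rho>) / 2 * (X f2 * Y g1) + (1 + \<rho>) / 2 * (X f2 * Y g2))) / 2"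
    using \<rho> by (intro divide_right_mono add_mono mult_left_mono S) auto
  also have "\<dots> = (X f1 * ((1 + \<rho>) / 2 * Y g1 + (1 - \<rho>) / 2 * Y g2)
      + X f2 * ((1 - \<rho>) / 2 * Y g1 + (1 + \<rho>) / 2 * Y g2)) / 2"
    by (simp add: algebra_simps)
  also have "\<dots> \<le> power_mean p (X f1) (X f2) * power_mean q (Y g1) (Y g2)"
    by (rule two_function_hypercontractive_bit[OF p q \<rho>]) (simp_all add: X_def Y_def)
  also have "power_mean p (X f1) (X f2) = cube_avg (insert i I) (\<lambda>x. f x powr p) powr (1 / p)"
    using p nn by (simp add: power_mean_def X_def powr_powr cube_avg_insert[OF insert.hyps] cube_avg_nonneg defs)
  also have "power_mean q (Y g1) (Y g2) = cube_avg (insert i I) (\<lambda>x. g x powr q) powr (1 / q)"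
    using q nn by (simp add: power_mean_def Y_def powr_powr cube_avg_insert[OF insert.hyps] cube_avg_nonneg defs)
  finally show ?case .
qed

section \<open>The function Theta\<close>

text \<open>
  With \<open>a = 1 / p\<close> and \<open>b = 1 / q\<close> the last equation says \<open>(p - 1) (q - 1) = \<rho>\<^sup>2\<close>, the
  condition of two-function hypercontractivity.
\<close>

definition hypercontractive_exponents :: "real \<Rightarrow> real \<Rightarrow> real \<Rightarrow> bool" where
  "hypercontractive_exponents \<rho> a b \<longleftrightarrow>
     0 < a \<and> a < 1 \<and> 0 < b \<and> b < 1 \<and> (1 - a) * (1 - b) = \<rho>\<^sup>2 * a * b"

lemma Theta0_nondegenerate:
  assumes "0 < \<rho>" "\<rho> < 1" "0 < \<alpha>" "0 < \<beta>"
  shows "Theta0 \<rho> \<alpha> \<beta> =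
    (let s = sqrt (- 2 * ln \<alpha>); t = sqrt (- 2 * ln \<beta>) in
       if \<rho> * s \<le> t \<and> t \<le> s / \<rho>
         then exp (- (s\<^sup>2 + t\<^sup>2 - 2 * \<rho> * s * t) / (2 * (1 - \<rho>\<^sup>2)))
       else if t \<le> \<rho> * s then \<alpha> else \<beta>)"
  using assms by (simp add: Theta0_def)

lemma eq_exp_sqrt_ln:
  assumes "0 < \<alpha>" "\<alpha> \<le> (1::real)"
  shows "\<alpha> = exp (- (sqrt (- 2 * ln \<alpha>))\<^sup>2 / 2)"
  using assms by simp

text \<open>
  For \<open>0 < \<rho> < 1\<close> and positive arguments, the next two lemmas together identify \<open>Theta0\<close> as the minimum, over all exponents admissible for
  hypercontractivity and their limits \<open>(1, 0)\<close> and \<open>(0, 1)\<close>, of the products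
  \<open>\<alpha>\<^bsup>a\<^esup> \<beta>\<^bsup>b\<^esup>\<close>. In the coordinates \<open>\<alpha> = exp (- s\<^sup>2 / 2)\<close>, \<open>\<beta> = exp (- t\<^sup>2 / 2)\<close> one
  maximizes the linear form \<open>a s\<^sup>2 + b t\<^sup>2\<close> over the curve \<open>(1 - a) (1 - b) = \<rho>\<^sup>2 a b\<close>; the
  maximizer is the one given in the proof.
\<close>

lemma Theta0_cases:
  assumes \<rho>: "0 < \<rho>" "\<rho> < 1" and \<alpha>: "0 < \<alpha>" "\<alpha> \<le> 1" and \<beta>: "0 < \<beta>" "\<beta> \<le> 1"
  obtains "Theta0 \<rho> \<alpha> \<beta> = \<alpha>" | "Theta0 \<rho> \<alpha> \<beta> = \<beta>"
  | a b where "hypercontractive_exponents \<rho> a b" "Theta0 \<rho> \<alpha> \<beta> = \<alpha> powr a * \<beta> powr b"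
proof -
  define s t where "s = sqrt (- 2 * ln \<alpha>)" and "t = sqrt (- 2 * ln \<beta>)"
  define D where "D = 1 - \<rho>\<^sup>2"
  have D: "0 < D" using \<rho> by (simp add: D_def power_less_one_iff abs_square_less_1)
  have \<alpha>_eq: "\<alpha> = exp (- s\<^sup>2 / 2)" and \<beta>_eq: "\<beta> = exp (- t\<^sup>2 / 2)"
    unfolding s_def t_def using \<alpha> \<beta> by (auto intro!: eq_exp_sqrt_ln)
  have st: "0 \<le> s" "0 \<le> t" using \<alpha> \<beta> by (auto simp: s_def t_def)
  have \<Theta>: "Theta0 \<rho> \<alpha> \<beta> = (if \<rho> * s \<le> t \<and> t \<le> s / \<rho>
      then exp (- (s\<^sup>2 + t\<^sup>2 - 2 * \<rho> * s * t) / (2 * D)) else if t \<le> \<rho> * s then \<alpha> else \<beta>)"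
    using Theta0_nondegenerate[OF \<rho> \<alpha>(1) \<beta>(1)] by (simp add: Let_def s_def t_def D_def)
  consider "\<not> (\<rho> * s \<le> t \<and> t \<le> s / \<rho>)" | "t = \<rho> * s" | "t = s / \<rho>" | "\<rho> * s < t" "t < s / \<rho>"
    by linarith
  then show ?thesis
  proof cases
    case 1
    then show ?thesis using \<Theta> that(1,2) by (auto split: if_splits)
  next
    case 2
    have "\<rho> * s \<le> s / \<rho>"
      using \<rho> st by (simp add: field_simps) (smt (verit) mult_left_le_one_le mult_nonneg_nonneg)
    have "s\<^sup>2 + t\<^sup>2 - 2 * \<rho> * s * t = s\<^sup>2 * D"
      by (simp add: 2 D_def power2_eq_square algebra_simps)
    then have "Theta0 \<rho> \<alpha> \<beta> = \<alpha>"
      using \<Theta> 2 D \<open>\<rho> * s \<le> s / \<rho>\<close> \<alpha>_eq by simp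
    then show ?thesis by (rule that(1))
  next
    case 3
    then have s: "s = \<rho> * t" using \<rho> by simp
    have "\<rho> * s \<le> t"
      using \<rho> st by (simp add: s) (smt (verit) mult_left_le_one_le mult_nonneg_nonneg)
    have "s\<^sup>2 + t\<^sup>2 - 2 * \<rho> * s * t = t\<^sup>2 * D"
      by (simp add: s D_def power2_eq_square algebra_simps)
    then have "Theta0 \<rho> \<alpha> \<beta> = \<beta>"
      using \<Theta> 3 D \<open>\<rho> * s \<le> t\<close> \<beta>_eq by simp
    then show ?thesis by (rule that(2))
  next
    case 4
    have st': "\<rho> * t < s" using 4 \<rho> by (simp add: field_simps)
    have "0 \<le> \<rho> * s" "0 \<le> \<rho> * t" using st \<rho> by simp_all
    then have pos: "0 < s" "0 < t" using 4 st' by linarith+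
    \<comment> \<open>The maximizer of \<open>a s\<^sup>2 + b t\<^sup>2\<close>; it has positive entries exactly in the open middle range.\<close>
    define a b where "a = (s - \<rho> * t) / (s * D)" and "b = (t - \<rho> * s) / (t * D)"
    have a1: "1 - a = \<rho> * (t - \<rho> * s) / (s * D)" and b1: "1 - b = \<rho> * (s - \<rho> * t) / (t * D)"
      using pos D by (auto simp: a_def b_def field_simps) (auto simp: D_def power2_eq_square algebra_simps)
    have "0 < 1 - a" "0 < 1 - b" "0 < a" "0 < b"
      unfolding a1 b1 using 4 st' pos D \<rho> by (auto simp: a_def b_def)
    moreover have "(1 - a) * (1 - b) = \<rho>\<^sup>2 * a * b"
      unfolding a1 b1 by (simp add: a_def b_def power2_eq_square)
    ultimately have ex: "hypercontractive_exponents \<rho> a b"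
      by (simp add: hypercontractive_exponents_def)
    have "a * s\<^sup>2 + b * t\<^sup>2 = (s\<^sup>2 + t\<^sup>2 - 2 * \<rho> * s * t) / D"
      using pos D by (simp add: a_def b_def field_simps power2_eq_square)
    then have "exp (- (s\<^sup>2 + t\<^sup>2 - 2 * \<rho> * s * t) / (2 * D)) = \<alpha> powr a * \<beta> powr b"
      unfolding \<alpha>_eq \<beta>_eq exp_powr_real mult_exp_exp using D by (simp add: field_simps)
    then show ?thesis
      using that(3)[OF ex] \<Theta> 4 by simp
  qed
qed

text \<open>
  The equation for \<open>a\<close> and \<open>b\<close> is equivalent to \<open>(1 - D a) (1 - D b) = \<rho>\<^sup>2\<close> with
  \<open>D = 1 - \<rho>\<^sup>2\<close>. In the middle range the claim then is the nonnegativity of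
  \<open>(1 - D a) s\<^sup>2 - 2 \<rho> s t + (1 - D b) t\<^sup>2\<close>, which is a perfect square.
\<close>

lemma Theta0_le_powr:
  assumes \<rho>: "0 < \<rho>" "\<rho> < 1" and \<alpha>: "0 \<le> \<alpha>" "\<alpha> \<le> 1" and \<beta>: "0 \<le> \<beta>" "\<beta> \<le> 1"
    and a: "0 \<le> a" "a \<le> 1" "0 \<le> b" "b \<le> 1" and eq: "(1 - a) * (1 - b) = \<rho>\<^sup>2 * a * b"
  shows "Theta0 \<rho> \<alpha> \<beta> \<le> \<alpha> powr a * \<beta> powr b"
proof (cases "\<alpha> * \<beta> = 0")
  case True
  then show ?thesis by (simp add: Theta0_def)
next
  case False
  then have pos: "0 < \<alpha>" "0 < \<beta>" using \<alpha> \<beta> by (auto simp: less_le)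
  define s t where "s = sqrt (- 2 * ln \<alpha>)" and "t = sqrt (- 2 * ln \<beta>)"
  define D where "D = 1 - \<rho>\<^sup>2"
  have D: "0 < D" "D < 1" using \<rho> by (auto simp: D_def power_less_one_iff abs_square_less_1)
  have \<alpha>_eq: "\<alpha> = exp (- s\<^sup>2 / 2)" and \<beta>_eq: "\<beta> = exp (- t\<^sup>2 / 2)"
    unfolding s_def t_def using \<alpha> \<beta> pos by (auto intro!: eq_exp_sqrt_ln)
  have st: "0 \<le> s" "0 \<le> t" using \<alpha> \<beta> pos by (auto simp: s_def t_def)
  have \<Theta>: "Theta0 \<rho> \<alpha> \<beta> = (if \<rho> * s \<le> t \<and> t \<le> s / \<rho>
      then exp (- (s\<^sup>2 + t\<^sup>2 - 2 * \<rho> * s * t) / (2 * D)) else if t \<le> \<rho> * s then \<alpha> else \<beta>)"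
    using Theta0_nondegenerate[OF \<rho> pos] by (simp add: Let_def s_def t_def D_def)
  have PQ: "(1 - D * a) * (1 - D * b) = \<rho>\<^sup>2"
  proof -
    have "a + b = 1 + D * a * b" using eq by (simp add: D_def algebra_simps)
    then have "D * (a + b) = D * (1 + D * a * b)" by simp
    then show ?thesis by (simp add: D_def algebra_simps)
  qed
  have "D * a \<le> D * 1" "D * b \<le> D * 1"
    using D a by (auto intro!: mult_left_mono)
  then have P: "0 < 1 - D * a" "0 < 1 - D * b"
    using D(2) by linarith+
  have goal: "\<alpha> powr a * \<beta> powr b = exp (- (a * s\<^sup>2 + b * t\<^sup>2) / 2)"
    unfolding \<alpha>_eq \<beta>_eq exp_powr_real mult_exp_exp by (simp add: field_simps)
  have boundary: "y * \<rho>\<^sup>2 \<le> 1 - x" if "(1 - x) * (1 - y) = \<rho>\<^sup>2 * x * y" "0 \<le> x" "x \<le> 1" "0 \<le> y" for x y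
  proof -
    have "1 - x = y * (\<rho>\<^sup>2 + D * (1 - x))" using that(1) by (simp add: D_def algebra_simps)
    moreover have "y * \<rho>\<^sup>2 \<le> y * (\<rho>\<^sup>2 + D * (1 - x))"
      using that D by (intro mult_left_mono) auto
    ultimately show ?thesis by simp
  qed
  consider "\<rho> * s \<le> t \<and> t \<le> s / \<rho>" | "\<not> (\<rho> * s \<le> t \<and> t \<le> s / \<rho>)" "t \<le> \<rho> * s" | "\<not> t \<le> \<rho> * s" "s \<le> \<rho> * t" "\<not> t \<le> s / \<rho>"
    using \<rho> by (fastforce simp: field_simps)
  then show ?thesis
  proof cases
    case 1
    have "0 \<le> (sqrt (1 - D * a) * s - sqrt (1 - D * b) * t)\<^sup>2" by simp
    also have "\<dots> = (1 - D * a) * s\<^sup>2 + (1 - D * b) * t\<^sup>2 - 2 * (sqrt (1 - D * a) * sqrt (1 - D * b)) * s * t"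
      using P by (simp add: power2_diff power_mult_distrib)
    also have "sqrt (1 - D * a) * sqrt (1 - D * b) = \<rho>"
      using \<rho> by (simp add: PQ flip: real_sqrt_mult)
    finally have "D * (a * s\<^sup>2 + b * t\<^sup>2) \<le> s\<^sup>2 + t\<^sup>2 - 2 * \<rho> * s * t"
      by (simp add: algebra_simps)
    then have "- (s\<^sup>2 + t\<^sup>2 - 2 * \<rho> * s * t) / (2 * D) \<le> - (a * s\<^sup>2 + b * t\<^sup>2) / 2"
      using D by (simp add: field_simps)
    then show ?thesis unfolding goal using \<Theta> 1 by simp
  next
    case 2
    have "b * t\<^sup>2 \<le> b * (\<rho> * s)\<^sup>2"
      using 2 st a by (intro mult_left_mono power_mono) auto
    also have "\<dots> = (b * \<rho>\<^sup>2) * s\<^sup>2" by (simp add: power_mult_distrib)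
    also have "\<dots> \<le> (1 - a) * s\<^sup>2"
      using boundary[OF eq] a by (intro mult_right_mono) auto
    finally have "exp (- s\<^sup>2 / 2) \<le> exp (- (a * s\<^sup>2 + b * t\<^sup>2) / 2)"
      by (simp add: algebra_simps)
    then show ?thesis
      unfolding goal \<Theta> if_not_P[OF 2(1)] if_P[OF 2(2)] using \<alpha>_eq by linarith
  next
    case 3
    have "a * s\<^sup>2 \<le> a * (\<rho> * t)\<^sup>2"
      using 3 st a by (intro mult_left_mono power_mono) auto
    also have "\<dots> = (a * \<rho>\<^sup>2) * t\<^sup>2" by (simp add: power_mult_distrib)
    also have "\<dots> \<le> (1 - b) * t\<^sup>2"
      using boundary[of b a] eq a by (intro mult_right_mono) (auto simp: ac_simps)
    finally have "exp (- t\<^sup>2 / 2) \<le> exp (- (a * s\<^sup>2 + b * t\<^sup>2) / 2)"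
      by (simp add: algebra_simps)
    moreover have *: "\<not> (\<rho> * s \<le> t \<and> t \<le> s / \<rho>)" using 3(3) by simp
    ultimately show ?thesis
      unfolding goal \<Theta> if_not_P[OF *] if_not_P[OF 3(1)] using \<beta>_eq by linarith
  qed
qed

text \<open>
  The tangent of a concave power, in a form that also covers \<open>y = 0\<close>.
\<close>

lemma powr_le_tangent:
  fixes x y b :: real
  assumes "0 < x" "0 \<le> y" "0 \<le> b" "b \<le> 1"
  shows "y powr b \<le> x powr b + b * x powr (b - 1) * (y - x)"
proof -
  have x: "x powr (b - 1) * x = x powr b" "x powr (b - 1) * x powr (1 - b) = 1"
    using assms by (simp_all add: powr_diff flip: powr_add)
  have "y powr b * x powr (1 - b) \<le> b * y + (1 - b) * x"
  proof (cases "y = 0")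
    case False
    then show ?thesis using Youngs_inequality_0[of b "1 - b" y x] assms by simp
  qed (use assms in simp)
  then have "x powr (b - 1) * (y powr b * x powr (1 - b)) \<le> x powr (b - 1) * (b * y + (1 - b) * x)"
    by (intro mult_left_mono) auto
  also have "x powr (b - 1) * (y powr b * x powr (1 - b)) = y powr b"
    using x(2) by (simp add: mult.left_commute)
  also have "x powr (b - 1) * (b * y + (1 - b) * x) = x powr b + b * x powr (b - 1) * (y - x)"
    unfolding x(1)[symmetric] by (simp add: algebra_simps)
  finally show ?thesis .
qed

text \<open>
  The upper bounds are the exponents \<open>(1, 0)\<close> and \<open>(0, 1)\<close>; the lower bound holds because
  the exponents do not exceed 1.
\<close>

lemma Theta0_bounds:
  assumes \<rho>: "0 \<le> \<rho>" "\<rho> \<le> 1" and \<alpha>: "0 \<le> \<alpha>" "\<alpha> \<le> 1" and \<beta>: "0 \<le> \<beta>" "\<beta> \<le> 1"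
  shows "\<alpha> * \<beta> \<le> Theta0 \<rho> \<alpha> \<beta>" and "Theta0 \<rho> \<alpha> \<beta> \<le> \<alpha>" and "Theta0 \<rho> \<alpha> \<beta> \<le> \<beta>"
proof -
  have m: "\<alpha> * \<beta> \<le> \<alpha>" "\<alpha> * \<beta> \<le> \<beta>"
    using \<alpha> \<beta> by (auto intro: mult_left_le mult_left_le_one_le)
  have "\<alpha> * \<beta> \<le> Theta0 \<rho> \<alpha> \<beta> \<and> Theta0 \<rho> \<alpha> \<beta> \<le> \<alpha> \<and> Theta0 \<rho> \<alpha> \<beta> \<le> \<beta>"
  proof (cases "\<alpha> * \<beta> = 0 \<or> \<rho> = 0 \<or> \<rho> = 1")
    case True
    then show ?thesis using m \<alpha> \<beta> unfolding Theta0_def by (auto simp: min_def)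
  next
    case False
    then have pos: "0 < \<alpha>" "0 < \<beta>" "0 < \<rho>" "\<rho> < 1" using \<alpha> \<beta> \<rho> by (auto simp: less_le)
    have "Theta0 \<rho> \<alpha> \<beta> \<le> \<alpha>" "Theta0 \<rho> \<alpha> \<beta> \<le> \<beta>"
      using Theta0_le_powr[of \<rho> \<alpha> \<beta> 1 0] Theta0_le_powr[of \<rho> \<alpha> \<beta> 0 1] pos \<alpha> \<beta> by auto
    moreover have "\<alpha> * \<beta> \<le> Theta0 \<rho> \<alpha> \<beta>"
    proof (cases rule: Theta0_cases[OF pos(3,4,1) \<alpha>(2) pos(2) \<beta>(2)])
      case (3 a b)
      have "x \<le> x powr c" if "0 < x" "x \<le> 1" "c \<le> 1" for x c :: real
        using powr_mono'[of c 1 x] that by simp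
      then show ?thesis
        using 3 pos \<alpha> \<beta> by (auto simp: hypercontractive_exponents_def intro!: mult_mono)
    qed (use m in auto)
    ultimately show ?thesis by auto
  qed
  then show "\<alpha> * \<beta> \<le> Theta0 \<rho> \<alpha> \<beta>" "Theta0 \<rho> \<alpha> \<beta> \<le> \<alpha>" "Theta0 \<rho> \<alpha> \<beta> \<le> \<beta>" by auto
qed

text \<open>
  \<open>Theta0\<close> is a minimum of concave functions of \<open>\<beta>\<close>, hence concave. What is used later is the
  existence of supporting lines from above: the tangent at \<open>\<beta>\<close> of the concave function that
  attains the minimum there also lies above \<open>Theta0\<close>.
\<close>

lemma Theta0_supergradient:
  assumes \<rho>: "0 \<le> \<rho>" "\<rho> \<le> 1" and \<alpha>: "0 \<le> \<alpha>" "\<alpha> \<le> 1" and \<beta>: "0 < \<beta>" "\<beta> \<le> 1"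
  shows "\<exists>m. \<forall>y\<in>{0..1}. Theta0 \<rho> \<alpha> y \<le> Theta0 \<rho> \<alpha> \<beta> + m * (y - \<beta>)"
proof (cases "\<alpha> = 0 \<or> \<rho> = 0")
  case True
  then have "Theta0 \<rho> \<alpha> y = \<alpha> * y" for y
    unfolding Theta0_def by auto
  then show ?thesis
    by (intro exI[of _ "\<alpha>"]) (simp add: algebra_simps)
next
  case False
  then have \<alpha>': "0 < \<alpha>" and \<rho>': "0 < \<rho>" using \<alpha> \<rho> by auto
  note bounds = Theta0_bounds[OF \<rho> \<alpha>]
  have const: ?thesis if "Theta0 \<rho> \<alpha> \<beta> = \<alpha>"
    using bounds(2) that by (intro exI[of _ 0]) simp
  have ident: ?thesis if "Theta0 \<rho> \<alpha> \<beta> = \<beta>"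
    using bounds(3) that by (intro exI[of _ 1]) simp
  show ?thesis
  proof (cases "\<rho> = 1")
    case True
    then have "Theta0 \<rho> \<alpha> \<beta> = min \<alpha> \<beta>" using \<alpha>' \<beta> by (simp add: Theta0_def)
    then show ?thesis using const ident by (cases "\<alpha> \<le> \<beta>") (simp_all add: min_def)
  next
    case False
    then have "\<rho> < 1" using \<rho> by simp
    show ?thesis
    proof (cases rule: Theta0_cases[OF \<rho>' \<open>\<rho> < 1\<close> \<alpha>' \<alpha>(2) \<beta>])
      case 1
      then show ?thesis by (rule const)
    next
      case 2
      then show ?thesis by (rule ident)
    next
      case (3 a b)
      have ab: "0 < a" "a < 1" "0 < b" "b < 1" "(1 - a) * (1 - b) = \<rho>\<^sup>2 * a * b"
        using 3 by (auto simp: hypercontractive_exponents_def)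
      show ?thesis
      proof (intro exI ballI)
        fix y :: real assume y: "y \<in> {0..1}"
        have "Theta0 \<rho> \<alpha> y \<le> \<alpha> powr a * y powr b"
          using Theta0_le_powr[OF \<rho>' \<open>\<rho> < 1\<close> \<alpha>, of y a b] ab y by simp
        also have "\<dots> \<le> \<alpha> powr a * (\<beta> powr b + b * \<beta> powr (b - 1) * (y - \<beta>))"
          using powr_le_tangent[of \<beta> y b] \<beta> y ab by (intro mult_left_mono) auto
        finally show "Theta0 \<rho> \<alpha> y \<le> Theta0 \<rho> \<alpha> \<beta> + (\<alpha> powr a * (b * \<beta> powr (b - 1))) * (y - \<beta>)"
          unfolding 3 by (simp add: algebra_simps)
      qed
    qed
  qed
qed

lemma Theta_bounds:
  assumes \<rho>: "0 \<le> \<rho>" "\<rho> \<le> 1" and \<alpha>: "0 \<le> \<alpha>" "\<alpha> \<le> 1" and \<beta>: "0 \<le> \<beta>" "\<beta> \<le> 1"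
  shows "\<alpha> * \<beta> \<le> Theta \<rho> \<alpha> \<beta>" and "Theta \<rho> \<alpha> \<beta> \<le> \<alpha>" and "Theta \<rho> \<alpha> \<beta> \<le> \<beta>"
proof -
  have "(1 - \<alpha>) * (1 - \<beta>) \<le> Theta0 \<rho> (1 - \<alpha>) (1 - \<beta>)"
    using assms by (intro Theta0_bounds) auto
  then have "\<alpha> * \<beta> \<le> \<alpha> + \<beta> - 1 + Theta0 \<rho> (1 - \<alpha>) (1 - \<beta>)"
    by (simp add: algebra_simps)
  then show "\<alpha> * \<beta> \<le> Theta \<rho> \<alpha> \<beta>" "Theta \<rho> \<alpha> \<beta> \<le> \<alpha>" "Theta \<rho> \<alpha> \<beta> \<le> \<beta>"
    using Theta0_bounds[OF assms] unfolding Theta_def by simp_all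
qed

lemma Theta_supergradient:
  assumes \<rho>: "0 \<le> \<rho>" "\<rho> \<le> 1" and \<alpha>: "0 \<le> \<alpha>" "\<alpha> \<le> 1" and \<beta>: "0 \<le> \<beta>" "\<beta> \<le> 1"
  shows "\<exists>m. \<forall>y\<in>{0..1}. Theta \<rho> \<alpha> y \<le> Theta \<rho> \<alpha> \<beta> + m * (y - \<beta>)"
proof -
  consider "\<beta> = 0" | "\<beta> = 1" | "0 < \<beta>" "\<beta> < 1" using \<beta> by linarith
  then show ?thesis
  proof cases
    case 1
    have "0 \<le> Theta \<rho> \<alpha> 0" using Theta_bounds(1)[OF \<rho> \<alpha>, of 0] by simp
    moreover have "Theta \<rho> \<alpha> y \<le> y" if "y \<in> {0..1}" for y
      using Theta_bounds(3)[OF \<rho> \<alpha>, of y] that by simp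
    ultimately show ?thesis unfolding 1 by (intro exI[of _ 1]) fastforce
  next
    case 2
    have "\<alpha> \<le> Theta \<rho> \<alpha> 1" using Theta_bounds(1)[OF \<rho> \<alpha>, of 1] by simp
    moreover have "Theta \<rho> \<alpha> y \<le> \<alpha>" if "y \<in> {0..1}" for y
      using Theta_bounds(2)[OF \<rho> \<alpha>, of y] that by simp
    ultimately show ?thesis unfolding 2 by (intro exI[of _ 0]) fastforce
  next
    case 3
    show ?thesis
    proof (cases "Theta \<rho> \<alpha> \<beta> = Theta0 \<rho> \<alpha> \<beta>")
      case True
      obtain m where m: "\<forall>y\<in>{0..1}. Theta0 \<rho> \<alpha> y \<le> Theta0 \<rho> \<alpha> \<beta> + m * (y - \<beta>)"
        using Theta0_supergradient[OF \<rho> \<alpha> 3(1)] 3 by auto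
      show ?thesis
      proof (intro exI ballI)
        fix y :: real assume "y \<in> {0..1}"
        moreover have "Theta \<rho> \<alpha> y \<le> Theta0 \<rho> \<alpha> y" by (simp add: Theta_def)
        ultimately show "Theta \<rho> \<alpha> y \<le> Theta \<rho> \<alpha> \<beta> + m * (y - \<beta>)"
          unfolding True using m by force
      qed
    next
      case False
      then have eq: "Theta \<rho> \<alpha> \<beta> = \<alpha> + \<beta> - 1 + Theta0 \<rho> (1 - \<alpha>) (1 - \<beta>)"
        by (simp add: Theta_def min_def split: if_splits)
      obtain m where m: "\<forall>y\<in>{0..1}. Theta0 \<rho> (1 - \<alpha>) y \<le> Theta0 \<rho> (1 - \<alpha>) (1 - \<beta>) + m * (y - (1 - \<beta>))"
        using Theta0_supergradient[OF \<rho>, of "1 - \<alpha>" "1 - \<beta>"] \<alpha> 3 by auto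
      show ?thesis
      proof (intro exI ballI)
        fix y :: real assume "y \<in> {0..1}"
        then have "Theta0 \<rho> (1 - \<alpha>) (1 - y) \<le> Theta0 \<rho> (1 - \<alpha>) (1 - \<beta>) + m * ((1 - y) - (1 - \<beta>))"
          using bspec[OF m, of "1 - y"] by simp
        moreover have "Theta \<rho> \<alpha> y \<le> \<alpha> + y - 1 + Theta0 \<rho> (1 - \<alpha>) (1 - y)"
          by (simp add: Theta_def)
        ultimately show "Theta \<rho> \<alpha> y \<le> Theta \<rho> \<alpha> \<beta> + (1 - m) * (y - \<beta>)"
          unfolding eq by (simp add: algebra_simps)
      qed
    qed
  qed
qed

lemma noise_rho_0:
  assumes "finite I"
  shows "noise 0 I g x = cube_avg I g"
proof -
  have "noise_kernel 0 I x y = (1 / 2) ^ card I" for y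
  proof -
    have "noise_kernel 0 I x y = (\<Prod>i\<in>I. 1 / 2)"
      unfolding noise_kernel_def by (intro prod.cong) auto
    then show ?thesis by simp
  qed
  then show ?thesis
    by (simp add: noise_def cube_avg_def power_divide sum_divide_distrib)
qed

text \<open>
  Indicator functions satisfy \<open>f\<^bsup>p\<^esup> = f\<close>, so two-function hypercontractivity bounds
  the noise stability by \<open>\<alpha>\<^bsup>a\<^esup> \<beta>\<^bsup>b\<^esup>\<close> for all admissible exponents; \<open>Theta0\<close> is the best
  of these bounds and of the trivial ones by \<open>\<alpha>\<close> and \<open>\<beta>\<close>.
\<close>

lemma stability_le_Theta0:
  assumes \<rho>: "0 \<le> \<rho>" "\<rho> \<le> 1" and I: "finite I"
    and f: "\<And>x. x \<in> subcube I \<Longrightarrow> f x \<in> {0, 1}" and g: "\<And>x. x \<in> subcube I \<Longrightarrow> g x \<in> {0, 1}"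
  shows "cube_avg I (\<lambda>x. f x * noise \<rho> I g x) \<le> Theta0 \<rho> (cube_avg I g) (cube_avg I f)"
proof -
  define \<alpha> \<beta> S where "\<alpha> = cube_avg I g" and "\<beta> = cube_avg I f" and "S = cube_avg I (\<lambda>x. f x * noise \<rho> I g x)"
  have g01: "0 \<le> g x" "g x \<le> 1" and f01: "0 \<le> f x" "f x \<le> 1" if "x \<in> subcube I" for x
    using f[OF that] g[OF that] by auto
  have T01: "0 \<le> noise \<rho> I g x" "noise \<rho> I g x \<le> 1" if "x \<in> subcube I" for x
    using noise_mono[OF \<rho>, of I g "\<lambda>_. 1" x, OF g01(2)] noise_mono[OF \<rho>, of I "\<lambda>_. 0" g x, OF g01(1)]
      noise_const[OF I that] by simp_all
  have ab: "0 \<le> \<alpha>" "\<alpha> \<le> 1" "0 \<le> \<beta>" "\<beta> \<le> 1"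
    using cube_avg_mono[of I g "\<lambda>_. 1", OF g01(2)] cube_avg_mono[of I f "\<lambda>_. 1", OF f01(2)]
      cube_avg_nonneg[of I g, OF g01(1)] cube_avg_nonneg[of I f, OF f01(1)]
    by (simp_all add: \<alpha>_def \<beta>_def cube_avg_const[OF I])
  have "S \<le> \<beta>"
    unfolding S_def \<beta>_def by (intro cube_avg_mono mult_left_le f01 T01)
  moreover have "S \<le> \<alpha>"
    unfolding S_def \<alpha>_def cube_avg_noise[OF I, of \<rho> g, symmetric]
    by (intro cube_avg_mono mult_left_le_one_le f01 T01)
  ultimately have S: "S \<le> \<alpha>" "S \<le> \<beta>" by simp_all
  have "S \<le> Theta0 \<rho> \<alpha> \<beta>"
  proof (cases "\<alpha> * \<beta> = 0 \<or> \<rho> = 0 \<or> \<rho> = 1")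
    case True
    have "S = \<alpha> * \<beta>" if "\<rho> = 0"
      using cube_avg_cmult[of I \<alpha> f] by (simp add: S_def that noise_rho_0[OF I] \<alpha>_def \<beta>_def mult.commute)
    moreover have "S \<le> 0" if "\<alpha> * \<beta> = 0" using that S by auto
    moreover have "Theta0 \<rho> \<alpha> \<beta> = (if \<alpha> * \<beta> = 0 then 0 else if \<rho> = 0 then \<alpha> * \<beta> else min \<alpha> \<beta>)"
      unfolding Theta0_def using True by auto
    ultimately show ?thesis using S by simp
  next
    case False
    then have pos: "0 < \<alpha>" "0 < \<beta>" "0 < \<rho>" "\<rho> < 1" using ab \<rho> by (auto simp: less_le)
    show ?thesis
    proof (cases rule: Theta0_cases[OF pos(3,4,1) ab(2) pos(2) ab(4)])
      case (3 a b)
      then have e: "0 < a" "a < 1" "0 < b" "b < 1" "(1 - a) * (1 - b) = \<rho>\<^sup>2 * a * b"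
        by (auto simp: hypercontractive_exponents_def)
      have "(1 / b - 1) * (1 / a - 1) = ((1 - a) * (1 - b)) / (a * b)"
        using e(1-4) by (simp add: field_simps)
      also have "\<dots> = \<rho>\<^sup>2" unfolding e(5) using e(1-4) by simp
      finally have pq: "(1 / b - 1) * (1 / a - 1) = \<rho>\<^sup>2" .
      have "1 < 1 / b" "1 < 1 / a" using e by simp_all
      from two_function_hypercontractive[OF this pos(3,4) pq I f01(1) g01(1)]
      have "S \<le> cube_avg I (\<lambda>x. f x powr (1 / b)) powr (1 / (1 / b)) * cube_avg I (\<lambda>x. g x powr (1 / a)) powr (1 / (1 / a))"
        unfolding S_def .
      also have "cube_avg I (\<lambda>x. f x powr (1 / b)) = \<beta>"
        unfolding \<beta>_def
      proof (rule cube_avg_cong)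
        fix x assume "x \<in> subcube I"
        from f[OF this] show "f x powr (1 / b) = f x" using e by auto
      qed
      also have "cube_avg I (\<lambda>x. g x powr (1 / a)) = \<alpha>"
        unfolding \<alpha>_def
      proof (rule cube_avg_cong)
        fix x assume "x \<in> subcube I"
        from g[OF this] show "g x powr (1 / a) = g x" using e by auto
      qed
      finally show ?thesis using 3 by (simp add: mult.commute)
    qed (simp_all add: S)
  qed
  then show ?thesis by (simp add: S_def \<alpha>_def \<beta>_def)
qed

text \<open>
  The second term of \<open>Theta\<close> is the first one for the complements of the two sets.
\<close>

lemma stability_le_Theta:
  assumes \<rho>: "0 \<le> \<rho>" "\<rho> \<le> 1" and I: "finite I"
    and f: "\<And>x. x \<in> subcube I \<Longrightarrow> f x \<in> {0, 1}" and g: "\<And>x. x \<in> subcube I \<Longrightarrow> g x \<in> {0, 1}"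
  shows "cube_avg I (\<lambda>x. f x * noise \<rho> I g x) \<le> Theta \<rho> (cube_avg I g) (cube_avg I f)"
proof -
  have "cube_avg I (\<lambda>x. (1 - f x) * noise \<rho> I (\<lambda>x. 1 - g x) x)
      \<le> Theta0 \<rho> (cube_avg I (\<lambda>x. 1 - g x)) (cube_avg I (\<lambda>x. 1 - f x))"
  proof (rule stability_le_Theta0[OF \<rho> I])
    fix x assume x: "x \<in> subcube I"
    show "1 - f x \<in> {0, 1}" using f[OF x] by auto
    show "1 - g x \<in> {0, 1}" using g[OF x] by auto
  qed
  also have "cube_avg I (\<lambda>x. (1 - f x) * noise \<rho> I (\<lambda>x. 1 - g x) x)
      = cube_avg I (\<lambda>x. 1 - f x - noise \<rho> I g x + f x * noise \<rho> I g x)"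
    by (intro cube_avg_cong) (simp add: noise_diff noise_const[OF I] algebra_simps)
  also have "\<dots> = 1 - cube_avg I f - cube_avg I g + cube_avg I (\<lambda>x. f x * noise \<rho> I g x)"
    by (simp add: cube_avg_add cube_avg_diff cube_avg_const[OF I] cube_avg_noise[OF I])
  also have "cube_avg I (\<lambda>x. 1 - g x) = 1 - cube_avg I g"
    by (simp add: cube_avg_diff cube_avg_const[OF I])
  also have "cube_avg I (\<lambda>x. 1 - f x) = 1 - cube_avg I f"
    by (simp add: cube_avg_diff cube_avg_const[OF I])
  finally show ?thesis
    using stability_le_Theta0[OF assms] unfolding Theta_def by simp
qed

section \<open>Supergradients and majorization\<close>

lemma supergradient_antimono:
  fixes F g :: "real \<Rightarrow> real"
  assumes g: "\<And>x y. x \<in> A \<Longrightarrow> y \<in> A \<Longrightarrow> F y \<le> F x + g x * (y - x)"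
    and "x \<in> A" "y \<in> A" "x \<le> y"
  shows "g y \<le> g x"
proof (cases "x = y")
  case False
  have "g y * (y - x) \<le> g x * (y - x)"
    using add_mono[OF g[OF assms(2,3)] g[OF assms(3,2)]] by (simp add: algebra_simps)
  then show ?thesis using False assms(4) by simp
qed simp

text \<open>
  A selection \<open>g\<close> of supergradients is decreasing, hence integrable. On an interval \<open>[x, y]\<close>
  both the increment of \<open>F\<close> and the integral of \<open>g\<close> lie between \<open>g y (y - x)\<close> and
  \<open>g x (y - x)\<close>. Cutting \<open>[a, b]\<close> into \<open>n\<close> equal pieces, the errors telescope to
  \<open>(g a - g b) (b - a) / n\<close>. In this way \<open>F\<close> may have infinitely many kinks.
\<close>

lemma supergradient_has_integral:
  fixes F g :: "real \<Rightarrow> real"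
  assumes "a \<le> b"
    and g: "\<And>x y. x \<in> {a..b} \<Longrightarrow> y \<in> {a..b} \<Longrightarrow> F y \<le> F x + g x * (y - x)"
  shows "(g has_integral (F b - F a)) {a..b}"
proof -
  note anti = supergradient_antimono[of "{a..b}" F g, OF g]
  have "mono_on {a..b} (\<lambda>x. - g x)"
    by (rule mono_onI) (use anti in auto)
  then have "(\<lambda>x. - g x) integrable_on {a..b}" by (rule integrable_on_mono_on)
  then have int: "g integrable_on {a..b}" using integrable_neg by force
  define D where "D x = F x - integral {a..x} g" for x
  have local: "\<bar>D y - D x\<bar> \<le> (g x - g y) * (y - x)" if "x \<in> {a..b}" "y \<in> {a..b}" "x \<le> y" for x y
  proof -
    have int': "g integrable_on {x..y}"
      using int that by (elim integrable_on_subinterval) auto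
    have "integral {a..x} g + integral {x..y} g = integral {a..y} g"
    proof (rule Henstock_Kurzweil_Integration.integral_combine)
      show "g integrable_on {a..y}"
        by (rule integrable_on_subinterval[OF int]) (use that in auto)
    qed (use that in auto)
    then have D: "D y - D x = (F y - F x) - integral {x..y} g" by (simp add: D_def)
    have "integral {x..y} g \<le> integral {x..y} (\<lambda>_. g x)"
      using that by (intro integral_le int') (auto intro!: anti)
    moreover have "integral {x..y} (\<lambda>_. g y) \<le> integral {x..y} g"
      using that by (intro integral_le int') (auto intro!: anti)
    ultimately have "integral {x..y} g \<le> g x * (y - x)" "g y * (y - x) \<le> integral {x..y} g"
      using that by (simp_all add: mult.commute)
    moreover have "F y - F x \<le> g x * (y - x)" "g y * (y - x) \<le> F y - F x"
      using g[of x y] g[of y x] that by (auto simp: algebra_simps)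
    ultimately show ?thesis
      unfolding D abs_le_iff left_diff_distrib by linarith
  qed
  have bound: "real n * \<bar>D b - D a\<bar> \<le> (g a - g b) * (b - a)" if n: "0 < n" for n :: nat
  proof -
    define h where "h = (b - a) / n"
    define x where "x k = a + real k * h" for k
    have h: "0 \<le> h" using assms n by (simp add: h_def)
    have xn: "x n = b" "x 0 = a" using n by (simp_all add: x_def h_def)
    have xI: "x k \<in> {a..b}" if "k \<le> n" for k
    proof -
      have "real k * h \<le> real n * h" using that h by (intro mult_right_mono) auto
      then show ?thesis using h xn by (auto simp: x_def)
    qed
    have "\<bar>D (x n) - D (x 0)\<bar> = \<bar>\<Sum>k<n. D (x (Suc k)) - D (x k)\<bar>"
      using sum_lessThan_telescope[of "\<lambda>k. D (x k)" n] by simp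
    also have "\<dots> \<le> (\<Sum>k<n. \<bar>D (x (Suc k)) - D (x k)\<bar>)" by (rule sum_abs)
    also have "\<dots> \<le> (\<Sum>k<n. (g (x k) - g (x (Suc k))) * h)"
    proof (rule sum_mono)
      fix k assume "k \<in> {..<n}"
      then show "\<bar>D (x (Suc k)) - D (x k)\<bar> \<le> (g (x k) - g (x (Suc k))) * h"
        using local[OF xI[of k] xI[of "Suc k"]] h by (simp add: x_def algebra_simps)
    qed
    also have "\<dots> = (g a - g b) * h"
      using sum_lessThan_telescope'[of "\<lambda>k. g (x k)" n] by (simp add: xn flip: sum_distrib_right)
    finally have "real n * \<bar>D b - D a\<bar> \<le> real n * ((g a - g b) * h)"
      unfolding xn by (intro mult_left_mono) auto
    also have "\<dots> = (g a - g b) * (b - a)" using n by (simp add: h_def)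
    finally show ?thesis .
  qed
  have "D b = D a"
  proof (rule ccontr)
    assume "D b \<noteq> D a"
    then obtain n where "(g a - g b) * (b - a) < real n * \<bar>D b - D a\<bar>"
      using reals_Archimedean3[of "\<bar>D b - D a\<bar>"] by auto
    moreover have "real n * \<bar>D b - D a\<bar> \<le> real (Suc n) * \<bar>D b - D a\<bar>" by (intro mult_right_mono) auto
    ultimately show False using bound[of "Suc n"] by simp
  qed
  then have "integral {a..b} g = F b - F a" by (simp add: D_def)
  then show ?thesis using int by (simp add: has_integral_integrable_integral)
qed

text \<open>
  Where \<open>g\<close> is continuous, the difference quotients of \<open>F\<close>, which lie between the values of
  \<open>g\<close> at the two points, are squeezed to \<open>g x\<close>; and a monotone function has only countably many
  discontinuities.
\<close>

lemma supergradient_deriv_countable: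
  fixes F g :: "real \<Rightarrow> real"
  assumes g: "\<And>x y. x \<in> {a..b} \<Longrightarrow> y \<in> {a..b} \<Longrightarrow> F y \<le> F x + g x * (y - x)"
  shows "countable {x \<in> {a<..<b}. \<not> (F has_real_derivative g x) (at x)}"
proof -
  note anti = supergradient_antimono[of "{a..b}" F g, OF g]
  have "(F has_real_derivative g x) (at x)" if x: "x \<in> {a<..<b}" and "isCont (\<lambda>x. - g x) x" for x
  proof -
    from that have cont: "g \<midarrow>x\<rightarrow> g x"
      using isCont_minus[of x "\<lambda>x. - g x"] by (simp add: isCont_def)
    have ev: "\<forall>\<^sub>F y in at x. y \<in> {a<..<b} \<and> y \<noteq> x"
      using x by (intro eventually_conj eventually_at_in_open'[of "{a<..<b}"] eventually_neq_at_within) auto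
    have sl: "min (g x) (g y) \<le> (F y - F x) / (y - x) \<and> (F y - F x) / (y - x) \<le> max (g x) (g y)"
      if y: "y \<in> {a<..<b}" "y \<noteq> x" for y
    proof -
      have "F y - F x \<le> g x * (y - x)" "g y * (y - x) \<le> F y - F x"
        using g[of x y] g[of y x] x y by (auto simp: algebra_simps)
      then show ?thesis
        using y(2) by (cases "x < y") (simp_all add: pos_divide_le_eq pos_le_divide_eq
            neg_divide_le_eq neg_le_divide_eq min_le_iff_disj le_max_iff_disj)
    qed
    have "((\<lambda>y. (F y - F x) / (y - x)) \<longlongrightarrow> g x) (at x)"
    proof (rule tendsto_sandwich)
      show "((\<lambda>y. min (g x) (g y)) \<longlongrightarrow> g x) (at x)" "((\<lambda>y. max (g x) (g y)) \<longlongrightarrow> g x) (at x)"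
        using tendsto_min[OF tendsto_const[of "g x"] cont] tendsto_max[OF tendsto_const[of "g x"] cont]
        by simp_all
      show "\<forall>\<^sub>F y in at x. min (g x) (g y) \<le> (F y - F x) / (y - x)"
        "\<forall>\<^sub>F y in at x. (F y - F x) / (y - x) \<le> max (g x) (g y)"
        by (rule eventually_mono[OF ev], use sl in blast)+
    qed
    then show ?thesis
      by (simp add: has_field_derivative_iff)
  qed
  then have "{x \<in> {a<..<b}. \<not> (F has_real_derivative g x) (at x)}
      \<subseteq> {x \<in> {a<..<b}. \<not> isCont (\<lambda>x. - g x) x}"
    by blast
  moreover have "countable {x \<in> {a<..<b}. \<not> isCont (\<lambda>x. - g x) x}"
    by (rule mono_on_ctble_discont_open) (auto intro!: mono_onI anti)
  ultimately show ?thesis by (rule countable_subset)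
qed

text \<open>
  Summation by parts: the weights decrease, so each partial sum enters with a nonnegative
  coefficient, except for the total sum, which vanishes.
\<close>

lemma sum_antimono_mult_nonneg:
  fixes m \<delta> :: "nat \<Rightarrow> real"
  assumes m: "\<And>i j. i \<le> j \<Longrightarrow> j < N \<Longrightarrow> m j \<le> m i"
    and part: "\<And>k. k \<le> N \<Longrightarrow> 0 \<le> (\<Sum>j<k. \<delta> j)"
    and tot: "(\<Sum>j<N. \<delta> j) = 0"
  shows "0 \<le> (\<Sum>j<N. m j * \<delta> j)"
proof -
  \<comment> \<open>For \<open>k = 0\<close> the index \<open>k - 1\<close> is 0, but it multiplies an empty sum.\<close>
  have "m (k - 1) * (\<Sum>j<k. \<delta> j) \<le> (\<Sum>j<k. m j * \<delta> j)" if "k \<le> N" for k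
    using that
  proof (induction k)
    case (Suc k)
    have "m k * (\<Sum>j<k. \<delta> j) \<le> m (k - 1) * (\<Sum>j<k. \<delta> j)"
      using Suc.prems m[of "k - 1" k] part[of k] by (intro mult_right_mono) auto
    then show ?case using Suc by (simp add: algebra_simps)
  qed simp
  from this[of N] tot show ?thesis by simp
qed

lemma shrink_in_unit_interval:
  fixes d w :: real
  assumes "0 < d" "d < 1" "w \<in> {0..1}"
  shows "(1 - d) * w + d / 2 \<in> {0<..<1}"
proof -
  define z where "z = (1 - d) * w"
  have "z \<le> (1 - d) * 1" "0 \<le> z"
    unfolding z_def using assms by (auto intro!: mult_left_mono)
  then show ?thesis
    unfolding z_def[symmetric] using assms(1) by simp
qed

lemma convex_on_subgradient:
  fixes \<Phi> :: "real \<Rightarrow> real"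
  assumes "convex_on {a..b} \<Phi>"
  obtains m where "\<And>x y. x \<in> {a<..<b} \<Longrightarrow> y \<in> {a..b} \<Longrightarrow> \<Phi> x + m x * (y - x) \<le> \<Phi> y"
proof (rule that)
  fix x y assume "x \<in> {a<..<b}" "y \<in> {a..b}"
  then show "\<Phi> x + Inf ((\<lambda>t. (\<Phi> x - \<Phi> t) / (x - t)) ` ({x<..} \<inter> {a..b})) * (y - x) \<le> \<Phi> y"
    using convex_le_Inf_differential[OF assms, of x y] by (simp only: interior_atLeastAtMost_real)
qed

lemma sorted_enumeration:
  fixes w :: "'a \<Rightarrow> real"
  assumes "finite X"
  obtains e where "bij_betw e {..<card X} X" "\<And>i j. i \<le> j \<Longrightarrow> j < card X \<Longrightarrow> w (e j) \<le> w (e i)"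
proof -
  obtain xs where xs: "set xs = X" "distinct xs" using finite_distinct_list[OF assms] by auto
  define ys where "ys = sort_key (\<lambda>x. - w x) xs"
  have ys: "set ys = X" "distinct ys" "sorted (map (\<lambda>x. - w x) ys)"
    using xs by (simp_all add: ys_def)
  have len: "length ys = card X" using ys distinct_card by metis
  show ?thesis
  proof (rule that[of "(!) ys"])
    show "bij_betw ((!) ys) {..<card X} X" using bij_betw_nth[OF ys(2) _ ys(1)[symmetric]] len by simp
    fix i j assume "i \<le> j" "j < card X"
    then show "w (ys ! j) \<le> w (ys ! i)"
      using sorted_nth_mono[OF ys(3), of i j] len by simp
  qed
qed

text \<open>
  A continuous form of the Hardy-Littlewood-Polya inequality. Write \<open>m\<close> for a subgradient of
  \<open>\<Phi>\<close> and list the values of \<open>w\<close> in decreasing order as \<open>w\<^sub>0, w\<^sub>1, \<dots>\<close>. On the \<open>j\<close>-th of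
  \<open>N\<close> equal intervals, \<open>\<Phi> \<circ> h\<close> is at least \<open>\<Phi> w\<^sub>j + m w\<^sub>j (h - w\<^sub>j)\<close>; integrating and summing,
  the linear terms contribute a nonnegative amount by summation by parts.

  A convex function that is continuous on the closed interval may have infinite slope at its ends.
  So the argument is carried out for the values \<open>(1 - d) w + d / 2\<close>, which lie in the open
  interval, and then \<open>d\<close> tends to 0; convexity gives
  \<open>\<Phi> ((1 - d) h + d / 2) \<le> (1 - d) \<Phi> h + d \<Phi> (1 / 2)\<close> on the other side.
\<close>

lemma majorization_integral:
  fixes w :: "'a \<Rightarrow> real" and h \<Phi> :: "real \<Rightarrow> real"
  assumes X: "finite X" "X \<noteq> {}"
    and \<Phi>: "continuous_on {0..1} \<Phi>" "convex_on {0..1} \<Phi>"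
    and w: "\<And>x. x \<in> X \<Longrightarrow> w x \<in> {0..1}"
    and h: "h integrable_on {0..1}" "\<And>t. t \<in> {0..1} \<Longrightarrow> h t \<in> {0..1}"
    and \<Phi>h: "(\<lambda>t. \<Phi> (h t)) integrable_on {0..1}"
    and part: "\<And>S. S \<subseteq> X \<Longrightarrow> (\<Sum>x\<in>S. w x) / card X \<le> integral {0..card S / card X} h"
    and tot: "(\<Sum>x\<in>X. w x) / card X = integral {0..1} h"
  shows "(\<Sum>x\<in>X. \<Phi> (w x)) / card X \<le> integral {0..1} (\<lambda>t. \<Phi> (h t))"
proof -
  define N where "N = card X"
  have N: "0 < N" using X by (simp add: N_def card_gt_0_iff)
  obtain m where m: "\<And>x y. x \<in> {0<..<1} \<Longrightarrow> y \<in> {0..1} \<Longrightarrow> \<Phi> x + m x * (y - x) \<le> \<Phi> y"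
    using convex_on_subgradient[OF \<Phi>(2)] by blast
  obtain e where e: "bij_betw e {..<N} X" "\<And>i j. i \<le> j \<Longrightarrow> j < N \<Longrightarrow> w (e j) \<le> w (e i)"
    using sorted_enumeration[OF X(1), of w] unfolding N_def by blast
  have eX: "e j \<in> X" if "j < N" for j using e(1) that by (auto simp: bij_betw_def)
  define c where "c k = real k / real N" for k
  have c: "c 0 = 0" "c N = 1" "\<And>k. c k \<le> c (Suc k)" "\<And>k. 0 \<le> c k" "\<And>k. k \<le> N \<Longrightarrow> c k \<le> 1"
    using N by (auto simp: c_def field_simps)
  have split: "integral {0..c k} u = (\<Sum>j<k. integral {c j..c (Suc j)} u)"
    if "k \<le> N" "u integrable_on {0..1}" for k and u :: "real \<Rightarrow> real"
    using that(1)
  proof (induction k)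
    case (Suc k)
    have "u integrable_on {0..c (Suc k)}"
      using that(2) c(5)[OF Suc.prems] by (elim integrable_on_subinterval) auto
    then have "integral {0..c k} u + integral {c k..c (Suc k)} u = integral {0..c (Suc k)} u"
      by (intro Henstock_Kurzweil_Integration.integral_combine c)
    with Suc show ?case by simp
  qed (simp add: c)
  have sub: "u integrable_on {c j..c (Suc j)}" if "j < N" "u integrable_on {0..1}" for j and u :: "real \<Rightarrow> real"
    using that(2) c(4)[of j] c(5)[of "Suc j"] that(1) by (elim integrable_on_subinterval) auto
  have width: "c (Suc j) - c j = 1 / N" for j by (simp add: c_def diff_divide_distrib[symmetric])
  have affine: "((\<lambda>t. A + B * u t) has_integral A / N + B * integral {c j..c (Suc j)} u) {c j..c (Suc j)}"
    if "j < N" "u integrable_on {0..1}" for j A B and u :: "real \<Rightarrow> real"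
    using has_integral_add[OF has_integral_const_real[of A "c j" "c (Suc j)"]
        has_integral_mult_right[OF integrable_integral[OF sub[OF that]], of B]] c(3)[of j]
    by (simp add: width)

  have approx: "(\<Sum>x\<in>X. \<Phi> ((1 - d) * w x + d / 2)) / N
      \<le> (1 - d) * integral {0..1} (\<lambda>t. \<Phi> (h t)) + d * \<Phi> (1 / 2)" if d: "0 < d" "d < 1" for d
  proof -
    define v where "v j = (1 - d) * w (e j) + d / 2" for j
    have v: "v j \<in> {0<..<1}" if "j < N" for j
      unfolding v_def by (rule shrink_in_unit_interval[OF d w[OF eX[OF that]]])
    have vm: "v j \<le> v i" if "i \<le> j" "j < N" for i j
      using e(2)[OF that] d by (simp add: v_def)
    have mm: "m (v j) \<le> m (v i)" if "i \<le> j" "j < N" for i j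
    proof (cases "v i = v j")
      case False
      have "m (v j) * (v i - v j) \<le> m (v i) * (v i - v j)"
      proof -
        have "v i \<in> {0<..<1}" "v j \<in> {0<..<1}" using v that by auto
        then have "\<Phi> (v i) + m (v i) * (v j - v i) \<le> \<Phi> (v j)" "\<Phi> (v j) + m (v j) * (v i - v j) \<le> \<Phi> (v i)"
          by (auto intro!: m)
        then show ?thesis by (simp add: algebra_simps)
      qed
      then show ?thesis using False vm[OF that] by simp
    qed simp
    define \<delta> where "\<delta> j = integral {c j..c (Suc j)} h - w (e j) / N" for j
    have sums: "(\<Sum>j<k. \<delta> j) = integral {0..c k} h - (\<Sum>x\<in>e ` {..<k}. w x) / N" if "k \<le> N" for k
    proof -
      have "inj_on e {..<k}" using e(1) that by (auto simp: bij_betw_def inj_on_def)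
      then show ?thesis
        by (simp add: \<delta>_def sum_subtractf split[OF that h(1)] sum.reindex sum_divide_distrib)
    qed
    have "0 \<le> (\<Sum>j<N. m (v j) * \<delta> j)"
    proof (rule sum_antimono_mult_nonneg[of N "\<lambda>j. m (v j)"])
      fix k assume k: "k \<le> N"
      have "inj_on e {..<k}" using e(1) k by (auto simp: bij_betw_def inj_on_def)
      then have "card (e ` {..<k}) = k" by (simp add: card_image)
      moreover have "e ` {..<k} \<subseteq> X" using eX k by auto
      ultimately show "0 \<le> (\<Sum>j<k. \<delta> j)"
        using part[of "e ` {..<k}"] unfolding sums[OF k] c_def N_def by simp
    next
      have "e ` {..<N} = X" using e(1) by (simp add: bij_betw_def)
      then show "(\<Sum>j<N. \<delta> j) = 0"
        unfolding sums[OF order_refl] c(2) using tot[folded N_def] by simp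
    qed (use mm in auto)
    have piece: "\<Phi> (v j) / N + (1 - d) * (m (v j) * \<delta> j)
        \<le> (1 - d) * integral {c j..c (Suc j)} (\<lambda>t. \<Phi> (h t)) + d * \<Phi> (1 / 2) / N" if j: "j < N" for j
    proof -
      have "(\<Phi> (v j) + m (v j) * (d / 2 - v j)) / N + (1 - d) * m (v j) * integral {c j..c (Suc j)} h
          \<le> d * \<Phi> (1 / 2) / N + (1 - d) * integral {c j..c (Suc j)} (\<lambda>t. \<Phi> (h t))"
      proof (rule has_integral_le[OF affine[OF j h(1)] affine[OF j \<Phi>h]])
        fix t assume t: "t \<in> {c j..c (Suc j)}"
        then have ht: "h t \<in> {0..1}" using h(2)[of t] c(4)[of j] c(5)[of "Suc j"] j by auto
        have "(1 - d) * h t + d / 2 \<in> {0..1}"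
          using shrink_in_unit_interval[OF d ht] by simp
        then have "\<Phi> (v j) + m (v j) * ((1 - d) * h t + d / 2 - v j) \<le> \<Phi> ((1 - d) * h t + d / 2)"
          using m[OF v[OF j]] by blast
        also have "\<dots> \<le> (1 - d) * \<Phi> (h t) + d * \<Phi> (1 / 2)"
          using convex_onD[OF \<Phi>(2), of d "h t" "1 / 2"] d ht by simp
        finally show "(\<Phi> (v j) + m (v j) * (d / 2 - v j)) + (1 - d) * m (v j) * h t \<le> d * \<Phi> (1 / 2) + (1 - d) * \<Phi> (h t)"
          by (simp add: algebra_simps)
      qed
      moreover have "m (v j) * (d / 2 - v j) / N = - ((1 - d) * m (v j) * (w (e j) / N))"
        by (simp add: v_def)
      ultimately show ?thesis
        by (simp add: \<delta>_def add_divide_distrib right_diff_distrib mult.assoc)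
    qed
    have "(\<Sum>x\<in>X. \<Phi> ((1 - d) * w x + d / 2)) / N = (\<Sum>j<N. \<Phi> (v j) / N)"
      using sum.reindex_bij_betw[OF e(1), of "\<lambda>x. \<Phi> ((1 - d) * w x + d / 2)"]
      by (simp add: v_def flip: sum_divide_distrib)
    also have "\<dots> \<le> (\<Sum>j<N. \<Phi> (v j) / N) + (1 - d) * (\<Sum>j<N. m (v j) * \<delta> j)"
      using d \<open>0 \<le> (\<Sum>j<N. m (v j) * \<delta> j)\<close> by simp
    also have "\<dots> = (\<Sum>j<N. \<Phi> (v j) / N + (1 - d) * (m (v j) * \<delta> j))"
      by (simp add: sum.distrib sum_distrib_left)
    also have "\<dots> \<le> (\<Sum>j<N. (1 - d) * integral {c j..c (Suc j)} (\<lambda>t. \<Phi> (h t)) + d * \<Phi> (1 / 2) / N)"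
      by (intro sum_mono piece) auto
    also have "\<dots> = (1 - d) * integral {0..1} (\<lambda>t. \<Phi> (h t)) + d * \<Phi> (1 / 2)"
      using split[of N, OF _ \<Phi>h] N by (simp add: sum.distrib c flip: sum_distrib_left)
    finally show ?thesis .
  qed
  have lim: "((\<lambda>d. (\<Sum>x\<in>X. \<Phi> ((1 - d) * w x + d / 2)) / N) \<longlongrightarrow> (\<Sum>x\<in>X. \<Phi> (w x)) / N) (at_right 0)"
  proof (intro tendsto_divide tendsto_sum tendsto_const)
    fix x assume x: "x \<in> X"
    have "((\<lambda>d. (1 - d) * w x + d / 2) \<longlongrightarrow> (1 - 0) * w x + 0 / 2) (at_right 0)"
      by (intro tendsto_intros) auto
    moreover have "\<forall>\<^sub>F d in at_right (0::real). (1 - d) * w x + d / 2 \<in> {0..1}"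
    proof -
      have "\<forall>\<^sub>F d in at_right (0::real). d \<in> {0<..<1}"
        by (intro eventually_at_right_real) auto
      then show ?thesis
      proof (rule eventually_mono)
        fix d :: real assume d: "d \<in> {0<..<1}"
        then show "(1 - d) * w x + d / 2 \<in> {0..1}"
          using shrink_in_unit_interval[OF _ _ w[OF x], of d] by simp
      qed
    qed
    ultimately show "((\<lambda>d. \<Phi> ((1 - d) * w x + d / 2)) \<longlongrightarrow> \<Phi> (w x)) (at_right 0)"
      using w[OF x] by (intro continuous_on_tendsto_compose[OF \<Phi>(1)]) auto
  qed (use N in auto)
  have lim2: "((\<lambda>d. (1 - d) * integral {0..1} (\<lambda>t. \<Phi> (h t)) + d * \<Phi> (1 / 2))
      \<longlongrightarrow> (1 - 0) * integral {0..1} (\<lambda>t. \<Phi> (h t)) + 0 * \<Phi> (1 / 2)) (at_right 0)"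
    by (intro tendsto_intros)
  have "\<forall>\<^sub>F d in at_right (0::real). d \<in> {0<..<1}"
    by (intro eventually_at_right_real) auto
  then have "\<forall>\<^sub>F d in at_right 0. (\<Sum>x\<in>X. \<Phi> ((1 - d) * w x + d / 2)) / N
      \<le> (1 - d) * integral {0..1} (\<lambda>t. \<Phi> (h t)) + d * \<Phi> (1 / 2)"
    by (rule eventually_mono) (use approx in auto)
  then show ?thesis
    using tendsto_le[OF _ lim2 lim] by (simp add: N_def)
qed

text \<open>
  Measurability passes through \<open>\<Phi>\<close> after \<open>\<Phi>\<close> is extended to the line by clamping.
\<close>

lemma continuous_compose_integrable:
  fixes \<Phi> h :: "real \<Rightarrow> real"
  assumes \<Phi>: "continuous_on {0..1} \<Phi>" and h: "h integrable_on {0..1}" "\<And>t. t \<in> {0..1} \<Longrightarrow> h t \<in> {0..1}"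
  shows "(\<lambda>t. \<Phi> (h t)) integrable_on {0..1}"
proof -
  let ?clamp = "\<lambda>x::real. max 0 (min 1 x)"
  have clamp: "?clamp x \<in> {0..1}" for x by auto
  have hm: "h \<in> borel_measurable (lebesgue_on {0..1})"
    using h(1) by (rule integrable_imp_measurable)
  have "continuous_on UNIV (\<lambda>x. \<Phi> (?clamp x))"
    by (rule continuous_on_compose2[OF \<Phi>]) (use clamp in \<open>auto intro!: continuous_intros\<close>)
  then have "(\<lambda>x. \<Phi> (?clamp x)) \<in> borel_measurable borel"
    by (rule borel_measurable_continuous_onI)
  then have meas: "(\<lambda>t. \<Phi> (?clamp (h t))) \<in> borel_measurable (lebesgue_on {0..1})"
    using hm by (rule measurable_compose[rotated])
  have "bounded (\<Phi> ` {0..1})"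
    using compact_continuous_image[OF \<Phi>] compact_imp_bounded by blast
  then obtain B where "\<forall>y\<in>\<Phi> ` {0..1}. \<bar>y\<bar> \<le> B"
    unfolding bounded_real by blast
  then have B: "\<bar>\<Phi> (?clamp x)\<bar> \<le> B" for x
    using clamp by blast
  have "(\<lambda>t. \<Phi> (?clamp (h t))) integrable_on {0..1}"
    by (rule measurable_bounded_by_integrable_imp_integrable_real[OF meas integrable_const_ivl B]) simp
  then show ?thesis
  proof (rule integrable_eq)
    fix t :: real assume "t \<in> {0..1}"
    from h(2)[OF this] have "?clamp (h t) = h t" by auto
    then show "\<Phi> (?clamp (h t)) = \<Phi> (h t)" by simp
  qed
qed

section \<open>The bound for a single coordinate\<close>

text \<open>
  Off a countable set \<open>theta \<rho> \<alpha>\<close> agrees with a selection of supergradients of \<open>Theta \<rho> \<alpha>\<close>, whose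
  integrals recover \<open>Theta\<close>. In the interior these lie in \<open>[0, 1]\<close>, by comparing the supporting
  line with the values 0 and \<open>\<alpha>\<close> of \<open>Theta\<close> at the ends; they are clamped to make this hold everywhere.
\<close>

lemma theta_representative:
  assumes \<rho>: "0 \<le> \<rho>" "\<rho> \<le> 1" and \<alpha>: "0 \<le> \<alpha>" "\<alpha> \<le> 1"
  obtains h where "\<And>t. h t \<in> {0..1}" "countable {t \<in> {0..1}. theta \<rho> \<alpha> t \<noteq> h t}"
    "\<And>\<beta>. \<beta> \<in> {0..1} \<Longrightarrow> (h has_integral Theta \<rho> \<alpha> \<beta>) {0..\<beta>}"
proof -
  define F where "F = Theta \<rho> \<alpha>"
  have "\<forall>x\<in>{0..1}. \<exists>m. \<forall>y\<in>{0..1}. F y \<le> F x + m * (y - x)"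
    using Theta_supergradient[OF \<rho> \<alpha>] by (simp add: F_def)
  from bchoice[OF this] obtain g where "\<forall>x\<in>{0..1}. \<forall>y\<in>{0..1}. F y \<le> F x + g x * (y - x)" ..
  then have g: "F y \<le> F x + g x * (y - x)" if "x \<in> {0..1}" "y \<in> {0..1}" for x y
    using that by blast
  have F: "F x \<le> \<alpha>" "F x \<le> x" "\<alpha> * x \<le> F x" if "x \<in> {0..1}" for x
    using Theta_bounds[OF \<rho> \<alpha>, of x] that by (simp_all add: F_def)
  have F01: "F 0 = 0" "F 1 = \<alpha>" using F[of 0] F[of 1] by auto
  have g01: "g x \<in> {0..1}" if x: "x \<in> {0<..<1}" for x
  proof -
    have "0 \<le> F x + g x * (0 - x)" "\<alpha> \<le> F x + g x * (1 - x)"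
      using g[of x 0] g[of x 1] x unfolding F01 by auto
    moreover have "g x * (0 - x) = - (g x * x)" by simp
    moreover have "F x \<le> \<alpha>" "F x \<le> x" using F[of x] x by auto
    ultimately have "g x * x \<le> 1 * x" "0 * (1 - x) \<le> g x * (1 - x)"
      unfolding mult_1_left mult_zero_left by linarith+
    then have "g x \<le> 1" "0 \<le> g x"
      using x mult_right_le_imp_le[of "g x" x 1] mult_right_le_imp_le[of 0 "1 - x" "g x"] by simp_all
    then show ?thesis by simp
  qed
  define h where "h t = max 0 (min 1 (g t))" for t
  have hg: "h t = g t" if "t \<in> {0<..<1}" for t
    using g01[OF that] by (auto simp: h_def)
  show ?thesis
  proof (rule that[of h])
    show "h t \<in> {0..1}" for t by (simp add: h_def)
    have "countable ({0, 1} \<union> {x \<in> {0<..<1}. \<not> (F has_real_derivative g x) (at x)})"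
      using supergradient_deriv_countable[of 0 1 F g] g by auto
    moreover have "{t \<in> {0..1}. theta \<rho> \<alpha> t \<noteq> h t}
        \<subseteq> {0, 1} \<union> {x \<in> {0<..<1}. \<not> (F has_real_derivative g x) (at x)}"
    proof (rule subsetI, rule ccontr)
      fix t assume t: "t \<in> {t \<in> {0..1}. theta \<rho> \<alpha> t \<noteq> h t}"
        "t \<notin> {0, 1} \<union> {x \<in> {0<..<1}. \<not> (F has_real_derivative g x) (at x)}"
      then have "t \<in> {0<..<1}" "(F has_real_derivative g t) (at t)" by auto
      then have "theta \<rho> \<alpha> t = h t"
        using DERIV_imp_deriv[of F "g t" t] by (simp add: hg theta_def F_def)
      with t(1) show False by simp
    qed
    ultimately show "countable {t \<in> {0..1}. theta \<rho> \<alpha> t \<noteq> h t}"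
      by (rule countable_subset[rotated])
  next
    fix \<beta> :: real assume \<beta>: "\<beta> \<in> {0..1}"
    have "(g has_integral (F \<beta> - F 0)) {0..\<beta>}"
      using \<beta> by (intro supergradient_has_integral g) auto
    then have "(h has_integral (F \<beta> - F 0)) {0..\<beta>}"
      by (rule has_integral_spike[of "{0, 1}", rotated 2]) (use \<beta> in \<open>auto intro!: hg\<close>)
    then show "(h has_integral Theta \<rho> \<alpha> \<beta>) {0..\<beta>}"
      unfolding F01 by (simp add: F_def)
  qed
qed

lemma convex_combination_unit_interval:
  fixes c c' s t :: real
  assumes "0 \<le> c" "0 \<le> c'" "c + c' = 1" "s \<in> {0..1}" "t \<in> {0..1}"
  shows "c * s + c' * t \<in> {0..1}"
  using convexD[of "{0..1::real}" s t c c'] assms by simp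

text \<open>
  For a set \<open>S\<close> of density \<open>b\<close>, the sum of the noisy \<open>f\<close> over \<open>S\<close> is, up to normalization, the
  noise stability of \<open>S\<close> and \<open>f\<close>, hence at most \<open>Theta\<close> at \<open>b\<close>, which is the integral of \<open>h\<close> over \<open>[0, b]\<close>.
  Since this holds for every \<open>S\<close>, it survives taking convex combinations of two noisy functions,
  and majorization applies to the combination.
\<close>

lemma noise_convex_combination_le_integral:
  fixes \<Phi> :: "real \<Rightarrow> real"
  assumes \<Phi>: "continuous_on {0..1} \<Phi>" "convex_on {0..1} \<Phi>"
    and \<rho>: "0 \<le> \<rho>" "\<rho> \<le> 1" and I: "finite I" and c: "0 \<le> c" "0 \<le> c'" "c + c' = 1"
    and f: "\<And>x. x \<in> subcube I \<Longrightarrow> f x \<in> {0, 1}" and g: "\<And>x. x \<in> subcube I \<Longrightarrow> g x \<in> {0, 1}"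
    and h: "\<And>t. h t \<in> {0..1}" "\<And>\<beta>. \<beta> \<in> {0..1} \<Longrightarrow> (h has_integral Theta \<rho> (cube_avg I f) \<beta>) {0..\<beta>}"
    and k: "\<And>t. k t \<in> {0..1}" "\<And>\<beta>. \<beta> \<in> {0..1} \<Longrightarrow> (k has_integral Theta \<rho> (cube_avg I g) \<beta>) {0..\<beta>}"
  shows "cube_avg I (\<lambda>x. \<Phi> (c * noise \<rho> I f x + c' * noise \<rho> I g x))
       \<le> integral {0..1} (\<lambda>t. \<Phi> (c * h t + c' * k t))"
proof -
  define w where "w x = c * noise \<rho> I f x + c' * noise \<rho> I g x" for x
  have comb: "c * s + c' * t \<in> {0..1}" if "s \<in> {0..1}" "t \<in> {0..1}" for s t
    by (rule convex_combination_unit_interval[OF c that])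
  have noise01: "noise \<rho> I u x \<in> {0..1}"
    if u: "\<And>x. x \<in> subcube I \<Longrightarrow> u x \<in> {0, 1}" and x: "x \<in> subcube I" for u x
  proof -
    have "0 \<le> u x" "u x \<le> 1" if "x \<in> subcube I" for x using u[OF that] by auto
    then show ?thesis
      using noise_mono[OF \<rho>, of I u "\<lambda>_. 1" x] noise_mono[OF \<rho>, of I "\<lambda>_. 0" u x] noise_const[OF I x]
      by simp
  qed
  have avg01: "cube_avg I u \<in> {0..1}" if u: "\<And>x. x \<in> subcube I \<Longrightarrow> u x \<in> {0, 1}" for u
  proof -
    have "0 \<le> u x" "u x \<le> 1" if "x \<in> subcube I" for x using u[OF that] by auto
    then show ?thesis
      using cube_avg_mono[of I u "\<lambda>_. 1"] cube_avg_nonneg[of I u] by (simp add: cube_avg_const[OF I])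
  qed
  have card: "real (card (subcube I)) = 2 ^ card I" by (simp add: card_subcube[OF I])
  have avg_w: "(\<Sum>x\<in>subcube I. F x) / card (subcube I) = cube_avg I F" for F
    by (simp add: cube_avg_def card)
  have H: "((\<lambda>t. c * h t + c' * k t) has_integral
      (c * Theta \<rho> (cube_avg I f) \<beta> + c' * Theta \<rho> (cube_avg I g) \<beta>)) {0..\<beta>}" if "\<beta> \<in> {0..1}" for \<beta>
    by (intro has_integral_add has_integral_mult_right h k that)
  have Theta_1: "Theta \<rho> \<alpha> 1 = \<alpha>" if "\<alpha> \<in> {0..1}" for \<alpha>
    using Theta_bounds[OF \<rho>, of \<alpha> 1] that by simp
  have "(\<Sum>x\<in>subcube I. \<Phi> (w x)) / card (subcube I) \<le> integral {0..1} (\<lambda>t. \<Phi> (c * h t + c' * k t))"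
  proof (rule majorization_integral[OF _ _ \<Phi>])
    show "finite (subcube I)" using I by simp
    show "subcube I \<noteq> {}" by (simp add: subcube_def PiE_eq_empty_iff)
    show "w x \<in> {0..1}" if "x \<in> subcube I" for x
      unfolding w_def using that by (intro comb noise01 f g)
    show int: "(\<lambda>t. c * h t + c' * k t) integrable_on {0..1}"
      using H[of 1] by (auto simp: integrable_on_def)
    show "c * h t + c' * k t \<in> {0..1}" for t by (intro comb h k)
    show "(\<lambda>t. \<Phi> (c * h t + c' * k t)) integrable_on {0..1}"
      by (intro continuous_compose_integrable[OF \<Phi>(1) int] comb h k)
    show "(\<Sum>x\<in>subcube I. w x) / card (subcube I) = integral {0..1} (\<lambda>t. c * h t + c' * k t)"
      unfolding avg_w integral_unique[OF H[of 1, simplified]] w_def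
      by (simp add: cube_avg_add cube_avg_cmult cube_avg_noise[OF I] Theta_1[OF avg01[OF f]] Theta_1[OF avg01[OF g]])
  next
    fix S assume S: "S \<subseteq> subcube I"
    define b where "b = card S / card (subcube I)"
    have b: "cube_avg I (indicator S) = b"
      using S I by (simp add: cube_avg_def b_def card indicator_def sum.If_cases Int_absorb1)
    have ind: "indicator S x \<in> {0, 1::real}" for x by (simp add: indicator_def)
    have "(\<Sum>x\<in>S. w x) / card (subcube I) = cube_avg I (\<lambda>x. indicator S x * w x)"
    proof -
      have "(\<Sum>x\<in>S. w x) = (\<Sum>x\<in>subcube I. indicator S x * w x)"
        using S I by (intro sum.mono_neutral_cong_left) (auto simp: indicator_def)
      then show ?thesis by (simp add: avg_w[symmetric])
    qed
    also have "\<dots> = c * cube_avg I (\<lambda>x. indicator S x * noise \<rho> I f x)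
        + c' * cube_avg I (\<lambda>x. indicator S x * noise \<rho> I g x)"
      unfolding w_def cube_avg_cmult[symmetric] cube_avg_add[symmetric] by (simp add: algebra_simps)
    also have "\<dots> \<le> c * Theta \<rho> (cube_avg I f) b + c' * Theta \<rho> (cube_avg I g) b"
      unfolding b[symmetric] using c
      by (intro add_mono mult_left_mono stability_le_Theta[OF \<rho> I] ind f g) auto
    also have "\<dots> = integral {0..b} (\<lambda>t. c * h t + c' * k t)"
      using H[of b] avg01[of "indicator S", OF ind] unfolding b by (simp add: integral_unique)
    finally show "(\<Sum>x\<in>S. w x) / card (subcube I)
        \<le> integral {0..card S / card (subcube I)} (\<lambda>t. c * h t + c' * k t)"
      by (simp add: b_def)
  qed
  then show ?thesis unfolding avg_w w_def .
qed

lemma Gam_eq_integral_representatives: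
  fixes \<Phi> :: "real \<Rightarrow> real"
  assumes \<Phi>: "continuous_on {0..1} \<Phi>" and \<rho>: "0 \<le> \<rho>" "\<rho> \<le> 1"
    and h: "\<And>t. h t \<in> {0..1}" "h integrable_on {0..1}" "countable {t \<in> {0..1}. theta \<rho> (1 - \<epsilon>) t \<noteq> h t}"
    and k: "\<And>t. k t \<in> {0..1}" "k integrable_on {0..1}" "countable {t \<in> {0..1}. theta \<rho> \<epsilon> t \<noteq> k t}"
  shows "Gam \<Phi> \<rho> \<epsilon>
       = (integral {0..1} (\<lambda>t. \<Phi> ((1 + \<rho>) / 2 * h t + (1 - \<rho>) / 2 * k t))
        + integral {0..1} (\<lambda>t. \<Phi> ((1 - \<rho>) / 2 * h t + (1 + \<rho>) / 2 * k t))) / 2"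
proof -
  have int: "(\<lambda>t. \<Phi> (c * h t + c' * k t)) integrable_on {0..1}"
    if c: "0 \<le> c" "0 \<le> c'" "c + c' = 1" for c c'
  proof (rule continuous_compose_integrable[OF \<Phi>])
    show "(\<lambda>t. c * h t + c' * k t) integrable_on {0..1}"
      by (intro integrable_add integrable_on_mult_right h k)
    show "c * h t + c' * k t \<in> {0..1}" for t
      by (rule convex_combination_unit_interval[OF c h(1) k(1)])
  qed
  have "negligible ({t \<in> {0..1}. theta \<rho> (1 - \<epsilon>) t \<noteq> h t} \<union> {t \<in> {0..1}. theta \<rho> \<epsilon> t \<noteq> k t})"
    using h(3) k(3) unfolding negligible_iff_null_sets
    by (intro null_sets_completionI countable_imp_null_set_lborel) auto
  then have "integral {0..1} (\<lambda>\<beta>.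
       \<Phi> ((1 + \<rho>) / 2 * theta \<rho> (1 - \<epsilon>) \<beta> + (1 - \<rho>) / 2 * theta \<rho> \<epsilon> \<beta>) +
       \<Phi> ((1 - \<rho>) / 2 * theta \<rho> (1 - \<epsilon>) \<beta> + (1 + \<rho>) / 2 * theta \<rho> \<epsilon> \<beta>))
     = integral {0..1} (\<lambda>\<beta>. \<Phi> ((1 + \<rho>) / 2 * h \<beta> + (1 - \<rho>) / 2 * k \<beta>) +
       \<Phi> ((1 - \<rho>) / 2 * h \<beta> + (1 + \<rho>) / 2 * k \<beta>))"
    by (rule integral_spike) auto
  also have "\<dots> = integral {0..1} (\<lambda>t. \<Phi> ((1 + \<rho>) / 2 * h t + (1 - \<rho>) / 2 * k t))
        + integral {0..1} (\<lambda>t. \<Phi> ((1 - \<rho>) / 2 * h t + (1 + \<rho>) / 2 * k t))"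
    using \<rho> by (intro integral_add int) (auto simp: field_simps)
  finally show ?thesis by (simp add: Gam_def)
qed

lemma Gam_symmetric: "Gam \<Phi> \<rho> (1 - \<epsilon>) = Gam \<Phi> \<rho> \<epsilon>"
  by (simp add: Gam_def add.commute)

text \<open>
  The remaining lemmas express the expectations and the noise operator, which are given in terms of
  probability mass functions, by finite sums.
\<close>

lemma cube_eq_subcube: "cube n = subcube {1..n}"
  by (simp add: cube_def subcube_def)

lemma expectation_cube_pmf: "measure_pmf.expectation (cube_pmf n) F = cube_avg {1..n} F"
proof -
  have "card (cube n) = 2 ^ card {1..n}"
    unfolding cube_eq_subcube by (rule card_subcube) simp
  then show ?thesis
    unfolding cube_avg_def cube_eq_subcube[symmetric]
    by (simp add: cube_pmf_def integral_pmf_of_set)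
qed

lemma pmf_random_sign_flip:
  fixes s t :: int
  assumes "0 \<le> q" "q \<le> 1" "s \<in> {-1, 1}" "t \<in> {-1, 1}"
  shows "pmf (map_pmf (\<lambda>b. if b then - s else s) (bernoulli_pmf q)) t = (if t = s then 1 - q else q)"
proof -
  have "(\<lambda>b. if b then - s else s) -` {t} = (if t = s then {False} else {True})"
    using assms(3,4) by (auto split: if_splits)
  then show ?thesis
    using assms(1,2) by (simp add: pmf_map measure_pmf_single)
qed

lemma noise_op_eq_noise:
  assumes \<rho>: "0 \<le> \<rho>" "\<rho> \<le> 1" and x: "x \<in> cube n"
  shows "noise_op n \<rho> f x = noise \<rho> {1..n} f x"
proof -
  have xi: "x i \<in> {-1, 1}" if "i \<in> {1..n}" for i
    using x that by (auto simp: cube_def PiE_iff)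
  have supp: "y \<in> cube n" if "y \<in> set_pmf (flip_pmf n \<rho> x)" for y
    using that xi unfolding flip_pmf_def cube_def
    by (fastforce simp: set_Pi_pmf PiE_dflt_def PiE_iff extensional_def)
  have "noise_op n \<rho> f x = (\<Sum>y\<in>cube n. f y * pmf (flip_pmf n \<rho> x) y)"
    unfolding noise_op_eq[OF x] by (rule integral_measure_pmf_real) (use supp in auto)
  also have "\<dots> = (\<Sum>y\<in>cube n. noise_kernel \<rho> {1..n} x y * f y)"
  proof (rule sum.cong[OF refl])
    fix y assume y: "y \<in> cube n"
    have "pmf (flip_pmf n \<rho> x) y = noise_kernel \<rho> {1..n} x y"
      unfolding flip_pmf_def noise_kernel_def
    proof (subst pmf_Pi')
      show "y i = undefined" if "i \<notin> {1..n}" for i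
        using y that by (auto simp: cube_def PiE_iff extensional_def)
      show "(\<Prod>i\<in>{1..n}. pmf (map_pmf (\<lambda>b. if b then - x i else x i) (bernoulli_pmf ((1 - \<rho>) / 2))) (y i))
          = (\<Prod>i\<in>{1..n}. if y i = x i then (1 + \<rho>) / 2 else (1 - \<rho>) / 2)"
      proof (rule prod.cong[OF refl])
        fix i assume i: "i \<in> {1..n}"
        have "y i \<in> {-1, 1}" using y i by (auto simp: cube_def PiE_iff)
        then show "pmf (map_pmf (\<lambda>b. if b then - x i else x i) (bernoulli_pmf ((1 - \<rho>) / 2))) (y i)
            = (if y i = x i then (1 + \<rho>) / 2 else (1 - \<rho>) / 2)"
          using pmf_random_sign_flip[OF _ _ xi[OF i], of "(1 - \<rho>) / 2" "y i"] \<rho> by (simp add: field_simps)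
      qed
    qed simp
    then show "f y * pmf (flip_pmf n \<rho> x) y = noise_kernel \<rho> {1..n} x y * f y" by simp
  qed
  finally show ?thesis by (simp add: noise_def cube_eq_subcube)
qed

text \<open>
  The restrictions of \<open>f\<close> to the facets \<open>x\<^sub>i = 1\<close> and \<open>x\<^sub>i = -1\<close> have means \<open>1 - d\<close> and \<open>d\<close>, where \<open>d\<close>
  is the distance to the dictator \<open>i\<close>, because \<open>f\<close> is balanced. The two facets give the two terms of
  \<open>Gam\<close>, which is invariant under exchanging \<open>d\<close> and \<open>1 - d\<close>.
\<close>

lemma expectation_noise_le_Gam:
  fixes \<Phi> :: "real \<Rightarrow> real"
  assumes \<Phi>: "continuous_on {0..1} \<Phi>" "convex_on {0..1} \<Phi>" and \<rho>: "0 \<le> \<rho>" "\<rho> \<le> 1"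
    and f: "boolean_fun n f" "balanced n f" and i: "i \<in> {1..n}"
  shows "measure_pmf.expectation (cube_pmf n) (\<lambda>x. \<Phi> (noise_op n \<rho> f x)) \<le> Gam \<Phi> \<rho> (sym_dict_dist n f i)"
proof -
  define I where "I = {1..n} - {i}"
  have I: "finite I" "i \<notin> I" "insert i I = {1..n}" using i by (auto simp: I_def)
  define f1 f2 where "f1 = (\<lambda>x. f (x(i := 1)))" and "f2 = (\<lambda>x. f (x(i := -1)))"
  define d where "d = cube_avg I f2"
  have up: "x(i := 1) \<in> cube n" "x(i := -1) \<in> cube n" if "x \<in> subcube I" for x
    using upd_in_subcube[OF that, of _ i] by (simp_all add: I cube_eq_subcube)
  have f01: "f1 x \<in> {0, 1}" "f2 x \<in> {0, 1}" if "x \<in> subcube I" for x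
    using f(1) up[OF that] unfolding boolean_fun_def f1_def f2_def by blast+
  have "cube_avg {1..n} f = 1 / 2"
    using f(2) by (simp add: balanced_def expectation_cube_pmf)
  then have f1: "cube_avg I f1 = 1 - d"
    using cube_avg_insert[OF I(1,2), of f] by (simp add: I(3) f1_def[symmetric] f2_def[symmetric] d_def)
  have d01: "0 \<le> d" "d \<le> 1"
  proof -
    have "0 \<le> f1 x" "0 \<le> f2 x" if "x \<in> subcube I" for x
      using f01[OF that] by auto
    then have "0 \<le> cube_avg I f1" "0 \<le> cube_avg I f2"
      by (simp_all add: cube_avg_nonneg)
    then show "0 \<le> d" "d \<le> 1" by (simp_all add: f1 d_def)
  qed
  have dist: "dict_dist n f i = d"
  proof -
    define D where "D = sym_diff {x \<in> cube n. f x = 1} {x \<in> cube n. x i = 1}"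
    have "dict_dist n f i = cube_avg (insert i I) (indicator D)"
      unfolding dict_dist_def D_def[symmetric] I(3) expectation_cube_pmf[symmetric] by simp
    also have "\<dots> = (cube_avg I (\<lambda>x. indicator D (x(i := 1))) + cube_avg I (\<lambda>x. indicator D (x(i := -1)))) / 2"
      by (rule cube_avg_insert[OF I(1,2)])
    also have "cube_avg I (\<lambda>x. indicator D (x(i := 1))) = cube_avg I (\<lambda>x. 1 - f1 x)"
    proof (rule cube_avg_cong)
      fix x assume x: "x \<in> subcube I"
      have "x(i := 1) \<in> D \<longleftrightarrow> f1 x \<noteq> 1"
        using up(1)[OF x] by (simp add: D_def f1_def)
      then show "indicator D (x(i := 1)) = 1 - f1 x"
        using f01(1)[OF x] by (auto simp: indicator_def)
    qed
    also have "cube_avg I (\<lambda>x. indicator D (x(i := -1))) = cube_avg I f2"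
    proof (rule cube_avg_cong)
      fix x assume x: "x \<in> subcube I"
      have "x(i := -1) \<in> D \<longleftrightarrow> f2 x = 1"
        using up(2)[OF x] by (simp add: D_def f2_def)
      then show "indicator D (x(i := -1)) = f2 x"
        using f01(2)[OF x] by (auto simp: indicator_def)
    qed
    finally show ?thesis
      by (simp add: cube_avg_diff cube_avg_const[OF I(1)] f1 d_def[symmetric])
  qed
  have d01': "0 \<le> 1 - d" "1 - d \<le> 1" using d01 by simp_all
  obtain h where h: "\<And>t. h t \<in> {0..1}" "countable {t \<in> {0..1}. theta \<rho> (1 - d) t \<noteq> h t}"
    "\<And>\<beta>. \<beta> \<in> {0..1} \<Longrightarrow> (h has_integral Theta \<rho> (1 - d) \<beta>) {0..\<beta>}"
    by (rule theta_representative[OF \<rho> d01'], rule that)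
  obtain k where k: "\<And>t. k t \<in> {0..1}" "countable {t \<in> {0..1}. theta \<rho> d t \<noteq> k t}"
    "\<And>\<beta>. \<beta> \<in> {0..1} \<Longrightarrow> (k has_integral Theta \<rho> d \<beta>) {0..\<beta>}"
    by (rule theta_representative[OF \<rho> d01], rule that)
  have half: "cube_avg I (\<lambda>x. \<Phi> (c * noise \<rho> I f1 x + c' * noise \<rho> I f2 x))
       \<le> integral {0..1} (\<lambda>t. \<Phi> (c * h t + c' * k t))" if "0 \<le> c" "0 \<le> c'" "c + c' = 1" for c c'
  proof (rule noise_convex_combination_le_integral[where f = f1 and g = f2 and h = h and k = k, OF \<Phi> \<rho> I(1) that])
    show "(h has_integral Theta \<rho> (cube_avg I f1) \<beta>) {0..\<beta>}" if "\<beta> \<in> {0..1}" for \<beta>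
      unfolding f1 by (rule h(3)[OF that])
    show "(k has_integral Theta \<rho> (cube_avg I f2) \<beta>) {0..\<beta>}" if "\<beta> \<in> {0..1}" for \<beta>
      using k(3)[OF that] by (simp only: d_def)
  qed (fact f01 h(1) k(1))+
  have "measure_pmf.expectation (cube_pmf n) (\<lambda>x. \<Phi> (noise_op n \<rho> f x))
      = cube_avg (insert i I) (\<lambda>x. \<Phi> (noise \<rho> (insert i I) f x))"
    unfolding expectation_cube_pmf I(3)
    by (intro cube_avg_cong) (simp add: noise_op_eq_noise[OF \<rho>] cube_eq_subcube)
  also have "\<dots> = (cube_avg I (\<lambda>x. \<Phi> ((1 + \<rho>) / 2 * noise \<rho> I f1 x + (1 - \<rho>) / 2 * noise \<rho> I f2 x))
      + cube_avg I (\<lambda>x. \<Phi> ((1 - \<rho>) / 2 * noise \<rho> I f1 x + (1 + \<rho>) / 2 * noise \<rho> I f2 x))) / 2"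
    unfolding cube_avg_insert[OF I(1,2)] noise_insert[OF I(1,2)] f1_def f2_def ..
  also have "\<dots> \<le> (integral {0..1} (\<lambda>t. \<Phi> ((1 + \<rho>) / 2 * h t + (1 - \<rho>) / 2 * k t))
        + integral {0..1} (\<lambda>t. \<Phi> ((1 - \<rho>) / 2 * h t + (1 + \<rho>) / 2 * k t))) / 2"
    using \<rho> by (intro divide_right_mono add_mono half) (auto simp: field_simps)
  also have "\<dots> = Gam \<Phi> \<rho> d"
  proof (rule Gam_eq_integral_representatives[where h = h and k = k, OF \<Phi>(1) \<rho>, symmetric])
    show "h integrable_on {0..1}" "k integrable_on {0..1}"
      using h(3)[of 1] k(3)[of 1] has_integral_integrable by simp_all
  qed (fact h(1,2) k(1,2))+
  also have "\<dots> = Gam \<Phi> \<rho> (sym_dict_dist n f i)"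
    unfolding sym_dict_dist_def dist by (cases "d \<le> 1 - d") (simp_all add: min_def Gam_symmetric)
  finally show ?thesis .
qed

theorem theorem4p1:
  fixes \<Phi> :: "real \<Rightarrow> real" and \<rho> :: real and n :: nat and f :: "(nat \<Rightarrow> int) \<Rightarrow> real"
  assumes "continuous_on {0..1} \<Phi>" and "convex_on {0..1} \<Phi>"
    and "0 \<le> \<rho>" and "\<rho> \<le> 1"
    and "n \<ge> 1"
    and "boolean_fun n f" and "balanced n f"
  shows "measure_pmf.expectation (cube_pmf n) (\<lambda>x. \<Phi> (noise_op n \<rho> f x))
           \<le> Min ((\<lambda>i. Gam \<Phi> \<rho> (sym_dict_dist n f i)) ` {1..n})
       \<and> Min ((\<lambda>i. Gam \<Phi> \<rho> (sym_dict_dist n f i)) ` {1..n})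
           \<le> Gam \<Phi> \<rho> (min_dict_dist n f)"
proof
  have ne: "{1..n} \<noteq> {}" using assms(5) by simp
  show "measure_pmf.expectation (cube_pmf n) (\<lambda>x. \<Phi> (noise_op n \<rho> f x))
      \<le> Min ((\<lambda>i. Gam \<Phi> \<rho> (sym_dict_dist n f i)) ` {1..n})"
    using ne expectation_noise_le_Gam[OF assms(1-4,6,7)] by (intro Min.boundedI) auto
  have "min_dict_dist n f \<in> sym_dict_dist n f ` {1..n}"
    unfolding min_dict_dist_def using ne by (intro Min_in) auto
  then obtain i where "i \<in> {1..n}" "min_dict_dist n f = sym_dict_dist n f i" by blast
  then show "Min ((\<lambda>i. Gam \<Phi> \<rho> (sym_dict_dist n f i)) ` {1..n}) \<le> Gam \<Phi> \<rho> (min_dict_dist n f)"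
    by (intro Min_le) auto
qed

end
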